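(* Given any simplicial set $X$, there is a weak equivalence between $D(|X|_D)$ and $|X|$ in the category of topological spaces (i.e. a weak homotopy equivalence in one direction or the other between these two spaces).
   Context: A diffeological space is a set $X$ together with, for each $n\in\mathbb{N}$ and each open $U\subseteq\mathbb{R}^n$, a specified set of functions $U\to X$ called plots, such that: every constant map is a plot; if $U\to X$ is a plot and $V\to U$ is a smooth map between open subsets of Euclidean spaces then the composite $V\to X$ is a plot; and a function $U\to X$ whose restriction to each member of some open cover of $U$ is a plot is itself a plot. A map $f:X\to Y$ is smooth if $f\circ p$ is a plot of $Y$ for every plot $p$ of $X$. $\mathrm{Diff}$ is the (complete and cocomplete) category of diffeological spaces and smooth maps. $\mathbb{R}^n$ has as plots the usual smooth maps. A subset $A\subseteq X$ has the sub-diffeology: $U\to A$ is a plot iff $U\to A\hookrightarrow X$ is. For a diffeological space $Y$, $D(Y)$ is the topological space with underlying set $Y$ and the $D$-topology, i.e. the final topology induced by the plots of $Y$ (domains with their usual topology). Let $\mathbb{A}^n=\{(x_0,\dots,x_n)\in\mathbb{R}^{n+1}\mid\sum x_i=1\}$ with the sub-diffeology from $\mathbb{R}^{n+1}$. A map $f:\{0,\dots,n\}\to\{0,\dots,m\}$ in the simplicial category induces $f_*:\mathbb{A}^n\to\mathbb{A}^m$, $f_*(x)_j=\sum_{i\in f^{-1}(j)}x_i$. The diffeological realization of a simplicial set $X$ is $|X|_D=\operatorname{colim}_{\Delta^n\to X}\mathbb{A}^n$, the colimit in $\mathrm{Diff}$ over the category of simplices of $X$. $|X|$ is the usual geometric realization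 of $X$. *)

theory Defs
  imports "HOL-Homology.Homology"
begin

section \<open>Final topologies\<close>

definition final_topology ::
    "'b set \<Rightarrow> 'i set \<Rightarrow> ('i \<Rightarrow> 'a topology) \<Rightarrow> ('i \<Rightarrow> 'a \<Rightarrow> 'b) \<Rightarrow> 'b topology" where
  "final_topology S I T f =
     topology (\<lambda>W. W \<subseteq> S \<and> (\<forall>i\<in>I. openin (T i) {a \<in> topspace (T i). f i a \<in> W}))"

lemma openin_final_topology:
  "openin (final_topology S I T f) W \<longleftrightarrow>
     W \<subseteq> S \<and> (\<forall>i\<in>I. openin (T i) {a \<in> topspace (T i). f i a \<in> W})"
proof -
  have "istopology (\<lambda>W. W \<subseteq> S \<and> (\<forall>i\<in>I. openin (T i) {a \<in> topspace (T i). f i a \<in> W}))"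
    unfolding istopology_def
  proof (intro conjI allI impI)
    fix V W
    assume V: "V \<subseteq> S \<and> (\<forall>i\<in>I. openin (T i) {a \<in> topspace (T i). f i a \<in> V})"
      and W: "W \<subseteq> S \<and> (\<forall>i\<in>I. openin (T i) {a \<in> topspace (T i). f i a \<in> W})"
    show "V \<inter> W \<subseteq> S" using V by auto
    show "\<forall>i\<in>I. openin (T i) {a \<in> topspace (T i). f i a \<in> V \<inter> W}"
    proof
      fix i assume "i \<in> I"
      then have "openin (T i) ({a \<in> topspace (T i). f i a \<in> V} \<inter> {a \<in> topspace (T i). f i a \<in> W})"
        using V W by blast
      moreover have "{a \<in> topspace (T i). f i a \<in> V} \<inter> {a \<in> topspace (T i). f i a \<in> W}
          = {a \<in> topspace (T i). f i a \<in> V \<inter> W}" by auto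
      ultimately show "openin (T i) {a \<in> topspace (T i). f i a \<in> V \<inter> W}" by simp
    qed
  next
    fix K
    assume K: "\<forall>W\<in>K. W \<subseteq> S \<and> (\<forall>i\<in>I. openin (T i) {a \<in> topspace (T i). f i a \<in> W})"
    show "\<Union>K \<subseteq> S" using K by auto
    show "\<forall>i\<in>I. openin (T i) {a \<in> topspace (T i). f i a \<in> \<Union>K}"
    proof
      fix i assume "i \<in> I"
      then have "openin (T i) (\<Union>W\<in>K. {a \<in> topspace (T i). f i a \<in> W})"
        using K by blast
      moreover have "(\<Union>W\<in>K. {a \<in> topspace (T i). f i a \<in> W})
          = {a \<in> topspace (T i). f i a \<in> \<Union>K}" by auto
      ultimately show "openin (T i) {a \<in> topspace (T i). f i a \<in> \<Union>K}" by simp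
    qed
  qed
  then show ?thesis
    by (simp add: final_topology_def topology_inverse')
qed

lemma topspace_final_topology:
  assumes "\<And>i. i \<in> I \<Longrightarrow> f i \<in> topspace (T i) \<rightarrow> S"
  shows "topspace (final_topology S I T f) = S"
proof
  show "topspace (final_topology S I T f) \<subseteq> S"
    by (meson openin_final_topology openin_topspace)
  have "{a \<in> topspace (T i). f i a \<in> S} = topspace (T i)" if "i \<in> I" for i
    using assms[OF that] by auto
  then have "openin (final_topology S I T f) S"
    by (simp add: openin_final_topology)
  then show "S \<subseteq> topspace (final_topology S I T f)"
    by (rule openin_subset)
qed


section \<open>Smooth maps between open subsets of Euclidean spaces\<close>

text \<open>Euclidean \<open>n\<close>-space is the library's \<^const>\<open>Euclidean_space\<close>: the functions
  \<open>nat \<Rightarrow> real\<close> vanishing outside \<open>{..<n}\<close>. For open \<open>U\<close>, being \<open>C\<^sup>k\<close> means that all iterated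
  partial derivatives up to order \<open>k\<close> exist and are continuous on \<open>U\<close>.\<close>

primrec C_k_on :: "nat \<Rightarrow> nat \<Rightarrow> (nat \<Rightarrow> real) set \<Rightarrow> ((nat \<Rightarrow> real) \<Rightarrow> real) \<Rightarrow> bool" where
  "C_k_on 0 n U f \<longleftrightarrow> continuous_map (subtopology (Euclidean_space n) U) euclideanreal f"
| "C_k_on (Suc k) n U f \<longleftrightarrow>
     continuous_map (subtopology (Euclidean_space n) U) euclideanreal f \<and>
     (\<exists>g. \<forall>i<n. (\<forall>x\<in>U. ((\<lambda>t. f (x(i := t))) has_real_derivative g i x) (at (x i)))
               \<and> C_k_on k n U (g i))"

definition smooth_between ::
    "nat \<Rightarrow> (nat \<Rightarrow> real) set \<Rightarrow> nat \<Rightarrow> (nat \<Rightarrow> real) set \<Rightarrow> ((nat \<Rightarrow> real) \<Rightarrow> nat \<Rightarrow> real) \<Rightarrow> bool" where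
  "smooth_between m V n U g \<longleftrightarrow>
     openin (Euclidean_space m) V \<and> U \<subseteq> topspace (Euclidean_space n) \<and> g \<in> V \<rightarrow> U \<and>
     (\<forall>j<n. \<forall>k. C_k_on k m V (\<lambda>x. g x j))"


section \<open>Diffeological spaces\<close>

text \<open>\<open>plots Y n U\<close> is the set of plots \<open>U \<rightarrow> Y\<close> for \<open>U\<close> open in Euclidean \<open>n\<close>-space. Functions
  with domain \<open>U\<close> are represented extensionally, i.e. as elements of \<open>U \<rightarrow>\<^sub>E dcarrier Y\<close>.\<close>

record 'a diffeo_space =
  dcarrier :: "'a set"
  plots :: "nat \<Rightarrow> (nat \<Rightarrow> real) set \<Rightarrow> ((nat \<Rightarrow> real) \<Rightarrow> 'a) set"

definition diffeological_space :: "'a diffeo_space \<Rightarrow> bool" where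
  "diffeological_space Y \<longleftrightarrow>
     (\<forall>n U p. p \<in> plots Y n U \<longrightarrow> openin (Euclidean_space n) U \<and> p \<in> U \<rightarrow>\<^sub>E dcarrier Y) \<and>
     (\<forall>n U y. openin (Euclidean_space n) U \<and> y \<in> dcarrier Y \<longrightarrow> (\<lambda>u\<in>U. y) \<in> plots Y n U) \<and>
     (\<forall>n U p m V g. p \<in> plots Y n U \<and> smooth_between m V n U g \<longrightarrow> compose V p g \<in> plots Y m V) \<and>
     (\<forall>n U p \<V>. openin (Euclidean_space n) U \<and> p \<in> U \<rightarrow>\<^sub>E dcarrier Y \<and>
        (\<forall>V\<in>\<V>. openin (Euclidean_space n) V \<and> restrict p V \<in> plots Y n V) \<and> \<Union>\<V> = U \<longrightarrow>
        p \<in> plots Y n U)"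

definition diff_smooth :: "'a diffeo_space \<Rightarrow> 'b diffeo_space \<Rightarrow> ('a \<Rightarrow> 'b) \<Rightarrow> bool" where
  "diff_smooth Y Z f \<longleftrightarrow>
     f \<in> dcarrier Y \<rightarrow> dcarrier Z \<and>
     (\<forall>n U p. p \<in> plots Y n U \<longrightarrow> compose U f p \<in> plots Z n U)"

definition euclidean_diff :: "nat \<Rightarrow> (nat \<Rightarrow> real) diffeo_space" where
  "euclidean_diff m =
     \<lparr>dcarrier = topspace (Euclidean_space m),
      plots = \<lambda>n U. {p \<in> extensional U. smooth_between n U m (topspace (Euclidean_space m)) p}\<rparr>"

definition sub_diffeology :: "'a diffeo_space \<Rightarrow> 'a set \<Rightarrow> 'a diffeo_space" where
  "sub_diffeology Y A =
     \<lparr>dcarrier = A, plots = \<lambda>n U. {p \<in> plots Y n U. p \<in> U \<rightarrow>\<^sub>E A}\<rparr>"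

definition D_topology :: "'a diffeo_space \<Rightarrow> 'a topology" where
  "D_topology Y =
     final_topology (dcarrier Y) {(n, U, p). p \<in> plots Y n U}
       (\<lambda>(n, U, p). subtopology (Euclidean_space n) U) (\<lambda>(n, U, p). p)"

text \<open>The smallest diffeology on the set \<open>Q\<close> making all the maps \<open>\<iota> i : A i \<rightarrow> Q\<close> smooth.\<close>

definition final_diffeology ::
    "'b set \<Rightarrow> 'i set \<Rightarrow> ('i \<Rightarrow> 'a diffeo_space) \<Rightarrow> ('i \<Rightarrow> 'a \<Rightarrow> 'b) \<Rightarrow> 'b diffeo_space" where
  "final_diffeology Q I A \<iota> =
     \<lparr>dcarrier = Q,
      plots = \<lambda>n U. {p. openin (Euclidean_space n) U \<and> p \<in> U \<rightarrow>\<^sub>E Q \<and>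
        (\<forall>Z :: 'b diffeo_space. diffeological_space Z \<and> dcarrier Z = Q \<and>
           (\<forall>i\<in>I. diff_smooth (A i) Z (\<iota> i)) \<longrightarrow> p \<in> plots Z n U)}\<rparr>"

lemma diffeological_spaceD:
  assumes "diffeological_space Y"
  shows "p \<in> plots Y n U \<Longrightarrow> openin (Euclidean_space n) U"
    and "p \<in> plots Y n U \<Longrightarrow> p \<in> U \<rightarrow>\<^sub>E dcarrier Y"
    and "openin (Euclidean_space n) U \<Longrightarrow> y \<in> dcarrier Y \<Longrightarrow> (\<lambda>u\<in>U. y) \<in> plots Y n U"
    and "p \<in> plots Y n U \<Longrightarrow> smooth_between m V n U g \<Longrightarrow> compose V p g \<in> plots Y m V"
    and "openin (Euclidean_space n) U \<Longrightarrow> p \<in> U \<rightarrow>\<^sub>E dcarrier Y \<Longrightarrow>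
        (\<And>V. V \<in> \<V> \<Longrightarrow> openin (Euclidean_space n) V \<and> restrict p V \<in> plots Y n V) \<Longrightarrow>
        \<Union>\<V> = U \<Longrightarrow> p \<in> plots Y n U"
proof -
  note D = assms[unfolded diffeological_space_def]
  note D1 = conjunct1[OF D] and D2 = conjunct1[OF conjunct2[OF D]]
    and D3 = conjunct1[OF conjunct2[OF conjunct2[OF D]]]
    and D4 = conjunct2[OF conjunct2[OF conjunct2[OF D]]]
  show "p \<in> plots Y n U \<Longrightarrow> openin (Euclidean_space n) U"
    and "p \<in> plots Y n U \<Longrightarrow> p \<in> U \<rightarrow>\<^sub>E dcarrier Y"
    using D1 by simp_all
  show "openin (Euclidean_space n) U \<Longrightarrow> y \<in> dcarrier Y \<Longrightarrow> (\<lambda>u\<in>U. y) \<in> plots Y n U"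
    using D2 by simp
  show "p \<in> plots Y n U \<Longrightarrow> smooth_between m V n U g \<Longrightarrow> compose V p g \<in> plots Y m V"
    using D3[rule_format, OF conjI] .
  show "openin (Euclidean_space n) U \<Longrightarrow> p \<in> U \<rightarrow>\<^sub>E dcarrier Y \<Longrightarrow>
        (\<And>V. V \<in> \<V> \<Longrightarrow> openin (Euclidean_space n) V \<and> restrict p V \<in> plots Y n V) \<Longrightarrow>
        \<Union>\<V> = U \<Longrightarrow> p \<in> plots Y n U"
    by (rule D4[rule_format, of n U p \<V>], simp_all)
qed

lemma diffeological_spaceI:
  assumes "\<And>n U p. p \<in> plots Y n U \<Longrightarrow> openin (Euclidean_space n) U"
    and "\<And>n U p. p \<in> plots Y n U \<Longrightarrow> p \<in> U \<rightarrow>\<^sub>E dcarrier Y"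
    and "\<And>n U y. openin (Euclidean_space n) U \<Longrightarrow> y \<in> dcarrier Y \<Longrightarrow> (\<lambda>u\<in>U. y) \<in> plots Y n U"
    and "\<And>n U p m V g. p \<in> plots Y n U \<Longrightarrow> smooth_between m V n U g \<Longrightarrow> compose V p g \<in> plots Y m V"
    and "\<And>n U p \<V>. openin (Euclidean_space n) U \<Longrightarrow> p \<in> U \<rightarrow>\<^sub>E dcarrier Y \<Longrightarrow>
        (\<And>V. V \<in> \<V> \<Longrightarrow> openin (Euclidean_space n) V \<and> restrict p V \<in> plots Y n V) \<Longrightarrow>
        \<Union>\<V> = U \<Longrightarrow> p \<in> plots Y n U"
  shows "diffeological_space Y"
  unfolding diffeological_space_def
proof (intro conjI[OF _ conjI[OF _ conjI]] allI impI)
  show "openin (Euclidean_space n) U \<and> p \<in> U \<rightarrow>\<^sub>E dcarrier Y" if "p \<in> plots Y n U" for n U p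
    using assms(1)[OF that] assms(2)[OF that] by (rule conjI)
  show "(\<lambda>u\<in>U. y) \<in> plots Y n U" if "openin (Euclidean_space n) U \<and> y \<in> dcarrier Y" for n U y
    using that by (intro assms(3)) simp_all
  show "compose V p g \<in> plots Y m V" if "p \<in> plots Y n U \<and> smooth_between m V n U g" for n U p m V g
    using assms(4)[OF conjunct1[OF that] conjunct2[OF that]] .
  show "p \<in> plots Y n U" if "openin (Euclidean_space n) U \<and> p \<in> U \<rightarrow>\<^sub>E dcarrier Y \<and>
        (\<forall>V\<in>\<V>. openin (Euclidean_space n) V \<and> restrict p V \<in> plots Y n V) \<and> \<Union>\<V> = U" for n U p \<V>
    using that by (intro assms(5)[of n U p \<V>]) simp_all
qed

lemma diffeological_space_final_diffeology:
  fixes Q :: "'b set" and \<iota> :: "'i \<Rightarrow> 'a \<Rightarrow> 'b"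
  shows "diffeological_space (final_diffeology Q I A \<iota>)" (is "diffeological_space ?F")
proof -
  define good where "good = (\<lambda>Z :: 'b diffeo_space. diffeological_space Z \<and> dcarrier Z = Q \<and>
           (\<forall>i\<in>I. diff_smooth (A i) Z (\<iota> i)))"
  have C: "dcarrier ?F = Q" by (simp add: final_diffeology_def)
  have P: "p \<in> plots ?F n U \<longleftrightarrow> openin (Euclidean_space n) U \<and> p \<in> U \<rightarrow>\<^sub>E Q \<and>
      (\<forall>Z. good Z \<longrightarrow> p \<in> plots Z n U)" for n U p
    by (simp add: final_diffeology_def good_def)
  have G: "diffeological_space Z" "dcarrier Z = Q" if "good Z" for Z
    using that by (auto simp: good_def)
  show ?thesis
  proof (rule diffeological_spaceI)
    fix n U p assume "p \<in> plots ?F n U"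
    then show "openin (Euclidean_space n) U" "p \<in> U \<rightarrow>\<^sub>E dcarrier ?F"
      unfolding C P by blast+
  next
    fix n U y assume "openin (Euclidean_space n) U" "y \<in> dcarrier ?F"
    then show "(\<lambda>u\<in>U. y) \<in> plots ?F n U"
      unfolding C P using diffeological_spaceD(3)[OF G(1)] G(2) by (intro conjI allI impI) simp_all
  next
    fix n U p m V g assume p: "p \<in> plots ?F n U" and g: "smooth_between m V n U g"
    have "compose V p g \<in> V \<rightarrow>\<^sub>E Q"
      using p g by (auto simp: P smooth_between_def compose_def PiE_def Pi_def)
    moreover have "openin (Euclidean_space m) V"
      using g by (simp add: smooth_between_def)
    moreover have "compose V p g \<in> plots Z m V" if "good Z" for Z
      using diffeological_spaceD(4)[OF G(1)[OF that]] p g that unfolding P by blast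
    ultimately show "compose V p g \<in> plots ?F m V" unfolding P by blast
  next
    fix n U p \<V>
    assume U: "openin (Euclidean_space n) U" and p: "p \<in> U \<rightarrow>\<^sub>E dcarrier ?F"
      and V: "\<And>V. V \<in> \<V> \<Longrightarrow> openin (Euclidean_space n) V \<and> restrict p V \<in> plots ?F n V"
      and un: "\<Union>\<V> = U"
    have "p \<in> plots Z n U" if Z: "good Z" for Z
    proof (rule diffeological_spaceD(5)[OF G(1)[OF Z] U _ _ un])
      show "p \<in> U \<rightarrow>\<^sub>E dcarrier Z" using p G(2)[OF Z] C by simp
      show "openin (Euclidean_space n) V \<and> restrict p V \<in> plots Z n V" if "V \<in> \<V>" for V
        using V[OF that] Z unfolding P by blast
    qed
    then show "p \<in> plots ?F n U" unfolding P using U p C by simp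
  qed
qed

lemma diff_smooth_final_diffeology_coprojection:
  assumes "i \<in> I" "\<iota> i \<in> dcarrier (A i) \<rightarrow> Q"
    and "\<And>n U p. p \<in> plots (A i) n U \<Longrightarrow> openin (Euclidean_space n) U \<and> p \<in> U \<rightarrow>\<^sub>E dcarrier (A i)"
  shows "diff_smooth (A i) (final_diffeology Q I A \<iota>) (\<iota> i)"
  unfolding diff_smooth_def
proof (intro conjI allI impI)
  show "\<iota> i \<in> dcarrier (A i) \<rightarrow> dcarrier (final_diffeology Q I A \<iota>)"
    using assms(2) by (simp add: final_diffeology_def)
  fix n U p assume p: "p \<in> plots (A i) n U"
  then have "compose U (\<iota> i) p \<in> U \<rightarrow>\<^sub>E Q"
    using assms(2) assms(3)[OF p] by (fastforce simp: compose_def PiE_def Pi_def)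
  then show "compose U (\<iota> i) p \<in> plots (final_diffeology Q I A \<iota>) n U"
    using assms(1) assms(3)[OF p] p by (auto simp: final_diffeology_def diff_smooth_def)
qed

lemma diff_smooth_from_final_diffeology:
  assumes Z: "diffeological_space Z" and k: "k \<in> Q \<rightarrow> dcarrier Z"
    and \<iota>: "\<And>i. i \<in> I \<Longrightarrow> \<iota> i \<in> dcarrier (A i) \<rightarrow> Q"
    and A: "\<And>i n U p. i \<in> I \<Longrightarrow> p \<in> plots (A i) n U \<Longrightarrow>
        openin (Euclidean_space n) U \<and> p \<in> U \<rightarrow>\<^sub>E dcarrier (A i)"
    and sm: "\<And>i. i \<in> I \<Longrightarrow> diff_smooth (A i) Z (\<lambda>a. k (\<iota> i a))"
  shows "diff_smooth (final_diffeology Q I A \<iota>) Z k"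
proof -
  define W where "W = \<lparr>dcarrier = Q, plots = \<lambda>n U. {p. openin (Euclidean_space n) U \<and>
      p \<in> U \<rightarrow>\<^sub>E Q \<and> compose U k p \<in> plots Z n U}\<rparr>"
  have C: "dcarrier W = Q" by (simp add: W_def)
  have P: "p \<in> plots W n U \<longleftrightarrow> openin (Euclidean_space n) U \<and>
      p \<in> U \<rightarrow>\<^sub>E Q \<and> compose U k p \<in> plots Z n U" for n U p
    by (simp add: W_def)
  have "diffeological_space W"
  proof (rule diffeological_spaceI)
    fix n U p assume "p \<in> plots W n U"
    then show "openin (Euclidean_space n) U" "p \<in> U \<rightarrow>\<^sub>E dcarrier W"
      unfolding C P by blast+
  next
    fix n U y assume U: "openin (Euclidean_space n) U" and y: "y \<in> dcarrier W"
    have "compose U k (\<lambda>u\<in>U. y) = (\<lambda>u\<in>U. k y)"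
      by (auto simp: compose_def restrict_def)
    moreover have "(\<lambda>u\<in>U. k y) \<in> plots Z n U"
      using diffeological_spaceD(3)[OF Z U] k y C by auto
    ultimately show "(\<lambda>u\<in>U. y) \<in> plots W n U"
      unfolding P using U y C by simp
  next
    fix n U p m V g assume p: "p \<in> plots W n U" and g: "smooth_between m V n U g"
    have "compose V k (compose V p g) = compose V (compose U k p) g"
      using g by (auto simp: smooth_between_def compose_def restrict_def Pi_def)
    moreover have "compose V p g \<in> V \<rightarrow>\<^sub>E Q"
      using p g by (auto simp: P smooth_between_def compose_def PiE_def Pi_def)
    moreover have "openin (Euclidean_space m) V"
      using g by (simp add: smooth_between_def)
    ultimately show "compose V p g \<in> plots W m V"
      using p g diffeological_spaceD(4)[OF Z] unfolding P by auto
  next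
    fix n U p \<V>
    assume U: "openin (Euclidean_space n) U" and p: "p \<in> U \<rightarrow>\<^sub>E dcarrier W"
      and V: "\<And>V. V \<in> \<V> \<Longrightarrow> openin (Euclidean_space n) V \<and> restrict p V \<in> plots W n V"
      and un: "\<Union>\<V> = U"
    have "compose U k p \<in> plots Z n U"
    proof (rule diffeological_spaceD(5)[OF Z U _ _ un])
      show "compose U k p \<in> U \<rightarrow>\<^sub>E dcarrier Z"
        using p k by (fastforce simp: C compose_def PiE_def Pi_def)
      show "openin (Euclidean_space n) V \<and> restrict (compose U k p) V \<in> plots Z n V"
        if "V \<in> \<V>" for V
      proof -
        have "restrict (compose U k p) V = compose V k (restrict p V)"
          using un that by (auto simp: compose_def restrict_def)
        then show ?thesis using V[OF that] unfolding P by simp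
      qed
    qed
    then show "p \<in> plots W n U" unfolding P using U p C by simp
  qed
  moreover have "diff_smooth (A i) W (\<iota> i)" if i: "i \<in> I" for i
    unfolding diff_smooth_def
  proof (intro conjI allI impI)
    show "\<iota> i \<in> dcarrier (A i) \<rightarrow> dcarrier W" using \<iota>[OF i] C by simp
    fix n U p assume p: "p \<in> plots (A i) n U"
    have "compose U k (compose U (\<iota> i) p) = compose U (\<lambda>a. k (\<iota> i a)) p"
      by (auto simp: compose_def restrict_def)
    moreover have "compose U (\<iota> i) p \<in> U \<rightarrow>\<^sub>E Q"
      using \<iota>[OF i] A[OF i p] by (fastforce simp: compose_def PiE_def Pi_def)
    ultimately show "compose U (\<iota> i) p \<in> plots W n U"
      using sm[OF i] A[OF i p] p unfolding P diff_smooth_def by simp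
  qed
  ultimately have "p \<in> plots W n U" if "p \<in> plots (final_diffeology Q I A \<iota>) n U" for n U p
    using that C by (simp add: final_diffeology_def)
  then show ?thesis
    using k unfolding diff_smooth_def P by (simp add: final_diffeology_def)
qed


section \<open>Simplicial sets and the points of their realizations\<close>

text \<open>Morphisms \<open>[m] \<rightarrow> [n]\<close> of the simplex category, as extensional functions on \<open>{..m}\<close>.\<close>

definition simplex_maps :: "nat \<Rightarrow> nat \<Rightarrow> (nat \<Rightarrow> nat) set" where
  "simplex_maps m n = {f \<in> {..m} \<rightarrow>\<^sub>E {..n}. mono_on {..m} f}"

text \<open>\<open>act X m n f\<close> is the operator \<open>simplices X n \<rightarrow> simplices X m\<close> given by \<open>f : [m] \<rightarrow> [n]\<close>.\<close>

record 'a simp_set =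
  simplices :: "nat \<Rightarrow> 'a set"
  act :: "nat \<Rightarrow> nat \<Rightarrow> (nat \<Rightarrow> nat) \<Rightarrow> 'a \<Rightarrow> 'a"

definition simplicial_set :: "'a simp_set \<Rightarrow> bool" where
  "simplicial_set X \<longleftrightarrow>
     (\<forall>m n f. f \<in> simplex_maps m n \<longrightarrow> act X m n f \<in> simplices X n \<rightarrow> simplices X m) \<and>
     (\<forall>n. \<forall>x\<in>simplices X n. act X n n (\<lambda>i\<in>{..n}. i) x = x) \<and>
     (\<forall>l m n f g. f \<in> simplex_maps l m \<and> g \<in> simplex_maps m n \<longrightarrow>
        (\<forall>x\<in>simplices X n. act X l n (compose {..l} g f) x = act X l m f (act X m n g x)))"

text \<open>The map \<open>f\<^sub>*\<close> on coordinates, for \<open>f : [m] \<rightarrow> [n]\<close>.\<close>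

definition push_coords :: "nat \<Rightarrow> (nat \<Rightarrow> nat) \<Rightarrow> (nat \<Rightarrow> real) \<Rightarrow> (nat \<Rightarrow> real)" where
  "push_coords m f a = (\<lambda>j. \<Sum>i | i \<le> m \<and> f i = j. a i)"

text \<open>For a cosimplicial set \<open>F\<close> of subsets of \<open>nat \<Rightarrow> real\<close> with structure maps
  \<^const>\<open>push_coords\<close>, the colimit of \<open>F n\<close> over the category of simplices
  \<open>\<Delta>\<^sup>n \<rightarrow> X\<close>, as a quotient of the disjoint union of the copies \<open>{(n, x)} \<times> F n\<close>. A morphism
  in that category from \<open>(m, f\<^sup>* y)\<close> to \<open>(n, y)\<close> is given by \<open>f : [m] \<rightarrow> [n]\<close>.\<close>

definition realization_rel ::
    "'a simp_set \<Rightarrow> (nat \<Rightarrow> (nat \<Rightarrow> real) set) \<Rightarrow>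
     ((nat \<times> 'a \<times> (nat \<Rightarrow> real)) \<times> (nat \<times> 'a \<times> (nat \<Rightarrow> real))) set" where
  "realization_rel X F =
     {((m, act X m n f y, a), (n, y, push_coords m f a)) | m n f y a.
        f \<in> simplex_maps m n \<and> y \<in> simplices X n \<and> a \<in> F m}"

definition realization_class ::
    "'a simp_set \<Rightarrow> (nat \<Rightarrow> (nat \<Rightarrow> real) set) \<Rightarrow> nat \<times> 'a \<Rightarrow> (nat \<Rightarrow> real) \<Rightarrow>
     (nat \<times> 'a \<times> (nat \<Rightarrow> real)) set" where
  "realization_class X F = (\<lambda>(n, x) a. (realization_rel X F \<union> (realization_rel X F)\<inverse>)\<^sup>* `` {(n, x, a)})"

definition realization_points ::
    "'a simp_set \<Rightarrow> (nat \<Rightarrow> (nat \<Rightarrow> real) set) \<Rightarrow> (nat \<times> 'a \<times> (nat \<Rightarrow> real)) set set" where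
  "realization_points X F = {realization_class X F (n, x) a | n x a. x \<in> simplices X n \<and> a \<in> F n}"

abbreviation all_simplices :: "'a simp_set \<Rightarrow> (nat \<times> 'a) set" where
  "all_simplices X \<equiv> {(n, x). x \<in> simplices X n}"

lemma realization_class_glue:
  assumes "f \<in> simplex_maps m n" "y \<in> simplices X n" "a \<in> F m"
  shows "realization_class X F (m, act X m n f y) a = realization_class X F (n, y) (push_coords m f a)"
proof -
  let ?R = "realization_rel X F \<union> (realization_rel X F)\<inverse>"
  have 1: "((m, act X m n f y, a), (n, y, push_coords m f a)) \<in> ?R"
    using assms unfolding realization_rel_def by blast
  then have 2: "((n, y, push_coords m f a), (m, act X m n f y, a)) \<in> ?R" by blast
  show ?thesis
    using 1 2 by (auto simp: realization_class_def intro: converse_rtrancl_into_rtrancl)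
qed

lemma realization_desc:
  assumes glue: "\<And>m n f y a. f \<in> simplex_maps m n \<Longrightarrow> y \<in> simplices X n \<Longrightarrow> a \<in> F m \<Longrightarrow>
      h (m, act X m n f y) a = h (n, y) (push_coords m f a)"
  obtains k where "\<And>n x a. k (realization_class X F (n, x) a) = h (n, x) a"
proof -
  let ?R = "realization_rel X F \<union> (realization_rel X F)\<inverse>"
  define H where "H = (\<lambda>(n, x, a). h (n, x) a)"
  have step: "H s = H t" if "(s, t) \<in> ?R" for s t
    using that by (auto simp: realization_rel_def H_def glue)
  have eq: "H s = H t" if "(s, t) \<in> ?R\<^sup>*" for s t
    using that by (induction rule: rtrancl_induct) (use step in auto)
  define k where "k c = H (SOME s. s \<in> c)" for c
  have "k (realization_class X F (n, x) a) = h (n, x) a" for n x a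
  proof -
    have "(n, x, a) \<in> realization_class X F (n, x) a"
      by (simp add: realization_class_def)
    then have "(SOME s. s \<in> realization_class X F (n, x) a) \<in> realization_class X F (n, x) a"
      by (rule someI)
    then have "((n, x, a), (SOME s. s \<in> realization_class X F (n, x) a)) \<in> ?R\<^sup>*"
      by (simp add: realization_class_def)
    from eq[OF this] show ?thesis by (simp add: k_def H_def)
  qed
  then show ?thesis by (rule that)
qed


section \<open>The diffeological realization\<close>

definition affine_simplex :: "nat \<Rightarrow> (nat \<Rightarrow> real) set" where
  "affine_simplex n = {a \<in> topspace (Euclidean_space (Suc n)). (\<Sum>i\<le>n. a i) = 1}"

definition affine_simplex_diff :: "nat \<Rightarrow> (nat \<Rightarrow> real) diffeo_space" where
  "affine_simplex_diff n = sub_diffeology (euclidean_diff (Suc n)) (affine_simplex n)"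

text \<open>The colimit in the category of diffeological spaces: the colimit of underlying sets, with the
  final diffeology of the coprojections. The universal property is proved below.\<close>

definition diff_realization :: "'a simp_set \<Rightarrow> (nat \<times> 'a \<times> (nat \<Rightarrow> real)) set diffeo_space" where
  "diff_realization X =
     final_diffeology (realization_points X affine_simplex) (all_simplices X)
       (\<lambda>(n, x). affine_simplex_diff n) (realization_class X affine_simplex)"

lemma dcarrier_affine_simplex_diff: "dcarrier (affine_simplex_diff n) = affine_simplex n"
  by (simp add: affine_simplex_diff_def sub_diffeology_def)

lemma plots_affine_simplex_diff:
  "p \<in> plots (affine_simplex_diff m) n U \<Longrightarrow>
     openin (Euclidean_space n) U \<and> p \<in> U \<rightarrow>\<^sub>E dcarrier (affine_simplex_diff m)"
  by (auto simp: affine_simplex_diff_def sub_diffeology_def euclidean_diff_def smooth_between_def)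

lemma diffeological_space_diff_realization: "diffeological_space (diff_realization X)"
  by (simp add: diff_realization_def diffeological_space_final_diffeology)

lemma diff_realization_cocone:
  assumes "x \<in> simplices X n"
  shows "diff_smooth (affine_simplex_diff n) (diff_realization X)
           (realization_class X affine_simplex (n, x))"
proof -
  have "realization_class X affine_simplex (n, x)
      \<in> dcarrier (affine_simplex_diff n) \<rightarrow> realization_points X affine_simplex"
    using assms by (auto simp: realization_points_def dcarrier_affine_simplex_diff)
  then show ?thesis
    using diff_smooth_final_diffeology_coprojection
        [of "(n, x)" "all_simplices X" "realization_class X affine_simplex"
            "\<lambda>(n, x). affine_simplex_diff n" "realization_points X affine_simplex"]
      plots_affine_simplex_diff assms
    by (simp add: diff_realization_def)
qed

lemma diff_realization_universal:
  fixes X :: "'a simp_set" and Z :: "'z diffeo_space"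
  assumes Z: "diffeological_space Z"
    and sm: "\<And>n x. x \<in> simplices X n \<Longrightarrow> diff_smooth (affine_simplex_diff n) Z (h (n, x))"
    and glue: "\<And>m n f y a. f \<in> simplex_maps m n \<Longrightarrow> y \<in> simplices X n \<Longrightarrow> a \<in> affine_simplex m \<Longrightarrow>
      h (m, act X m n f y) a = h (n, y) (push_coords m f a)"
  shows "\<exists>!k. k \<in> extensional (dcarrier (diff_realization X)) \<and>
           diff_smooth (diff_realization X) Z k \<and>
           (\<forall>n. \<forall>x\<in>simplices X n. \<forall>a\<in>affine_simplex n.
              k (realization_class X affine_simplex (n, x) a) = h (n, x) a)"
proof -
  let ?c = "realization_class X affine_simplex"
  let ?Q = "realization_points X affine_simplex"
  have C: "dcarrier (diff_realization X) = ?Q"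
    by (simp add: diff_realization_def final_diffeology_def)
  obtain k0 where k0: "\<And>n x a. k0 (?c (n, x) a) = h (n, x) a"
    using realization_desc[where h = h and F = affine_simplex and X = X] glue by blast
  define k where "k = restrict k0 ?Q"
  have cQ: "?c (n, x) a \<in> ?Q" if "x \<in> simplices X n" "a \<in> affine_simplex n" for n x a
    using that by (auto simp: realization_points_def)
  have k: "k (?c (n, x) a) = h (n, x) a" if "x \<in> simplices X n" "a \<in> affine_simplex n" for n x a
    using that cQ by (simp add: k_def k0)
  have kZ: "k \<in> ?Q \<rightarrow> dcarrier Z"
    using sm k by (fastforce simp: realization_points_def diff_smooth_def dcarrier_affine_simplex_diff)
  have "diff_smooth (diff_realization X) Z k"
    unfolding diff_realization_def
  proof (rule diff_smooth_from_final_diffeology[OF Z kZ])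
    fix i assume i: "i \<in> all_simplices X"
    obtain n x where nx: "i = (n, x)" "x \<in> simplices X n" using i by auto
    show "?c i \<in> dcarrier (case i of (n, x) \<Rightarrow> affine_simplex_diff n) \<rightarrow> ?Q"
      using nx cQ by (auto simp: dcarrier_affine_simplex_diff)
    show "openin (Euclidean_space m) U \<and>
        p \<in> U \<rightarrow>\<^sub>E dcarrier (case i of (n, x) \<Rightarrow> affine_simplex_diff n)"
      if "p \<in> plots (case i of (n, x) \<Rightarrow> affine_simplex_diff n) m U" for m U p
      using that nx plots_affine_simplex_diff by auto
    have "compose U (\<lambda>a. k (?c (n, x) a)) p = compose U (h (n, x)) p"
      if "p \<in> plots (affine_simplex_diff n) m U" for m U p
      using plots_affine_simplex_diff[OF that] k nx(2)
      by (auto simp: compose_def restrict_def dcarrier_affine_simplex_diff PiE_def Pi_def)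
    then show "diff_smooth (case i of (n, x) \<Rightarrow> affine_simplex_diff n) Z (\<lambda>a. k (?c i a))"
      using sm[OF nx(2)] k nx
      by (auto simp: diff_smooth_def dcarrier_affine_simplex_diff)
  qed
  moreover have "k' = k" if "k' \<in> extensional ?Q"
    and k': "\<forall>n. \<forall>x\<in>simplices X n. \<forall>a\<in>affine_simplex n. k' (?c (n, x) a) = h (n, x) a" for k'
  proof (rule extensionalityI[OF that(1)])
    show "k \<in> extensional ?Q" by (simp add: k_def)
    show "k' c = k c" if "c \<in> ?Q" for c
      using that k k' by (auto simp: realization_points_def)
  qed
  moreover have "k \<in> extensional ?Q" by (simp add: k_def)
  ultimately show ?thesis unfolding C using k by (intro ex1I[of _ k] conjI allI ballI) blast+
qed


section \<open>The geometric realization\<close>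

definition geom_realization :: "'a simp_set \<Rightarrow> (nat \<times> 'a \<times> (nat \<Rightarrow> real)) set topology" where
  "geom_realization X =
     final_topology (realization_points X standard_simplex) (all_simplices X)
       (\<lambda>(n, x). subtopology (powertop_real UNIV) (standard_simplex n))
       (realization_class X standard_simplex)"


section \<open>Weak homotopy equivalences\<close>

definition cube :: "nat \<Rightarrow> (nat \<Rightarrow> real) topology" where
  "cube n = product_topology (\<lambda>_. top_of_set {0..1}) {..<n}"

definition cube_boundary :: "nat \<Rightarrow> (nat \<Rightarrow> real) set" where
  "cube_boundary n = {t \<in> topspace (cube n). \<exists>i<n. t i = 0 \<or> t i = 1}"

text \<open>The class of a map \<open>(I\<^sup>n, \<partial>I\<^sup>n) \<rightarrow> (X, x)\<close> modulo homotopy relative to the boundary. Values of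
  the representing functions outside the cube are irrelevant: functions agreeing on the cube lie in
  the same class.\<close>

definition sphere_class ::
    "nat \<Rightarrow> 'a topology \<Rightarrow> 'a \<Rightarrow> ((nat \<Rightarrow> real) \<Rightarrow> 'a) \<Rightarrow> ((nat \<Rightarrow> real) \<Rightarrow> 'a) set" where
  "sphere_class n X x g =
     {h. homotopic_with (\<lambda>q. \<forall>t\<in>cube_boundary n. q t = x) (cube n) X g h}"

definition homotopy_group :: "nat \<Rightarrow> 'a topology \<Rightarrow> 'a \<Rightarrow> ((nat \<Rightarrow> real) \<Rightarrow> 'a) set set" where
  "homotopy_group n X x =
     {sphere_class n X x g | g. continuous_map (cube n) X g \<and> (\<forall>t\<in>cube_boundary n. g t = x)}"

definition homotopy_group_map ::
    "nat \<Rightarrow> 'b topology \<Rightarrow> ('a \<Rightarrow> 'b) \<Rightarrow> 'a \<Rightarrow>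
     ((nat \<Rightarrow> real) \<Rightarrow> 'a) set \<Rightarrow> ((nat \<Rightarrow> real) \<Rightarrow> 'b) set" where
  "homotopy_group_map n Y f x c = (\<Union>g\<in>c. sphere_class n Y (f x) (f \<circ> g))"

text \<open>The bijection of path components is stated separately from the conditions at the
  base points, so that an empty space is equivalent only to an empty space. Since \<open>\<pi>\<^sub>n(f)\<close> is a group homomorphism for every continuous \<open>f\<close> and \<open>n \<ge> 1\<close>, it is an
  isomorphism iff it is bijective; the group structure need not be mentioned.\<close>

definition weak_homotopy_equivalence :: "'a topology \<Rightarrow> 'b topology \<Rightarrow> ('a \<Rightarrow> 'b) \<Rightarrow> bool" where
  "weak_homotopy_equivalence X Y f \<longleftrightarrow>
     continuous_map X Y f \<and>
     bij_betw (\<lambda>C. \<Union>x\<in>C. path_component_of_set Y (f x))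
       (path_components_of X) (path_components_of Y) \<and>
     (\<forall>n\<ge>1. \<forall>x\<in>topspace X.
        bij_betw (homotopy_group_map n Y f x) (homotopy_group n X x) (homotopy_group n Y (f x)))"

end

theory Submission
  imports Defs "HOL-Analysis.Abstract_Topological_Spaces"
begin

text \<open>
  The set underlying \<open>D(|X|\<^sub>D)\<close> is the colimit of the affine spaces \<open>A\<^sup>n\<close> over the simplices of \<open>X\<close>,
  and its topology is the colimit of their Euclidean topologies (\<open>D_topology_diff_realization\<close>):
  a set with open preimages has open preimage under each plot because the continuous maps form a
  diffeology containing the coprojections, and conversely \<open>A\<^sup>n\<close> is a smooth retract of
  \<open>\<real>\<^sup>n\<^sup>+\<^sup>1\<close>. The inclusions of the standard simplices into the \<open>A\<^sup>n\<close> induce a map from \<open>|X|\<close> to this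
  space, and the claim is that this map embeds \<open>|X|\<close> as a strong deformation retract; a direct
  argument with homotopies shows that such an inclusion is a weak homotopy equivalence.

  A retraction cannot be obtained from a natural family of maps \<open>A\<^sup>n \<rightarrow> \<Delta>\<^sup>n\<close>: compatibility with the
  degeneracies excludes that. It is constructed by descending through the skeleta. Let the boundary
  of \<open>A\<^sup>n\<close> be the union of the hyperplanes \<open>a\<^sub>i = 0\<close>. There is a retraction of \<open>A\<^sup>n\<close> onto the union of
  \<open>\<Delta>\<^sup>n\<close> and the boundary: on the region of a fixed sign pattern, raise all negative coordinates at a
  common speed and lower all others at a common speed, keeping the sum, until some coordinate
  vanishes (\<open>boundary_push\<close>). For a nondegenerate \<open>n\<close>-simplex this moves a point either into \<open>\<Delta>\<^sup>n\<close> or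
  to a face, where the next lower dimension takes over. As the push fixes the boundary
  pointwise, the \<open>n\<close>-cells can be treated independently of each other, and no naturality of the
  push is needed.

  To make this a definition on the colimit, a point \<open>(n, x, a)\<close> is reduced one dimension at a time:
  omit a vanishing coordinate and pass to the corresponding face, or undo a degeneracy of \<open>x\<close> and
  add two adjacent coordinates. By the simplicial identities two different reductions of a point
  have a common further reduction (\<open>reduces_diamond\<close>), which replaces the uniqueness of nondegenerate
  representatives. Hence a function defined by recursion along reductions and pushes, stopping as
  soon as a condition on the point is met, does not depend on the choices made
  (\<open>collapse_value_reduces\<close>) and is defined on the colimit. Its continuity follows by induction on
  the dimension from finite closed covers (\<open>continuous_map_R\<close>). This recursion is carried out with a
  parameter \<open>\<tau> \<in> [0,1]\<close>, and it is used twice: stopping only in \<open>\<Delta>\<^sup>n\<close> gives the retraction, and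
  stopping in dimension \<open>n\<close> also at times up to \<open>2\<^sup>-\<^sup>n\<close>, with the push of dimension \<open>n\<close> performed
  during \<open>[2\<^sup>-\<^sup>n\<^sup>-\<^sup>1, 2\<^sup>-\<^sup>n]\<close>, gives the homotopy from the identity to the retraction.
\<close>


section \<open>Final topologies and products with an interval\<close>

lemma continuous_map_coprojection:
  assumes "i \<in> I" "f i \<in> topspace (T i) \<rightarrow> S" "\<And>j. j \<in> I \<Longrightarrow> f j \<in> topspace (T j) \<rightarrow> S"
  shows "continuous_map (T i) (final_topology S I T f) (f i)"
proof -
  have "topspace (final_topology S I T f) = S" by (rule topspace_final_topology) (rule assms(3))
  then show ?thesis using assms by (auto simp: continuous_map_def openin_final_topology)
qed

lemma continuous_map_from_final_topology:
  assumes f: "\<And>i. i \<in> I \<Longrightarrow> f i \<in> topspace (T i) \<rightarrow> S"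
    and S: "\<And>q. q \<in> S \<Longrightarrow> \<exists>i\<in>I. \<exists>a\<in>topspace (T i). q = f i a"
    and g: "\<And>i. i \<in> I \<Longrightarrow> continuous_map (T i) Z (\<lambda>a. g (f i a))"
  shows "continuous_map (final_topology S I T f) Z g"
proof -
  have top: "topspace (final_topology S I T f) = S" by (rule topspace_final_topology) (rule f)
  have "g q \<in> topspace Z" if "q \<in> S" for q
    using S[OF that] g by (auto simp: continuous_map_def)
  moreover have "openin (final_topology S I T f) {q \<in> S. g q \<in> W}" if "openin Z W" for W
    unfolding openin_final_topology
  proof (intro conjI ballI)
    fix i assume i: "i \<in> I"
    have "{a \<in> topspace (T i). f i a \<in> {q \<in> S. g q \<in> W}} = {a \<in> topspace (T i). g (f i a) \<in> W}"
      using f[OF i] by auto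
    then show "openin (T i) {a \<in> topspace (T i). f i a \<in> {q \<in> S. g q \<in> W}}"
      using g[OF i] that by (simp add: continuous_map_def)
  qed auto
  ultimately show ?thesis by (auto simp: continuous_map_def top)
qed

text \<open>The product with \<open>[0,1]\<close> of a final topology is final for the products of the maps. The proof is
  the tube lemma: over a compact interval \<open>J\<close>, the points \<open>q\<close> with \<open>k \<tau> q \<in> W\<close> for all
  \<open>\<tau> \<in> J\<close> form an open set.\<close>
lemma continuous_map_prod_final_topology:
  fixes Z :: "'z topology" and f :: "'i \<Rightarrow> 'a \<Rightarrow> 'b"
  assumes f: "\<And>i. i \<in> I \<Longrightarrow> f i \<in> topspace (T i) \<rightarrow> S"
    and S: "\<And>q. q \<in> S \<Longrightarrow> \<exists>i\<in>I. \<exists>a\<in>topspace (T i). q = f i a"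
    and cont: "\<And>i. i \<in> I \<Longrightarrow>
        continuous_map (prod_topology (top_of_set {0..1::real}) (T i)) Z (\<lambda>(\<tau>, a). k \<tau> (f i a))"
  shows "continuous_map (prod_topology (top_of_set {0..1::real}) (final_topology S I T f)) Z
           (\<lambda>(\<tau>, q). k \<tau> q)"
proof -
  let ?F = "final_topology S I T f"
  have topF: "topspace ?F = S" by (rule topspace_final_topology) (use f in auto)
  have kZ: "k \<tau> q \<in> topspace Z" if "\<tau> \<in> {0..1}" "q \<in> S" for \<tau> q
  proof -
    obtain i a where "i \<in> I" "a \<in> topspace (T i)" "q = f i a" using S \<open>q \<in> S\<close> by blast
    then show ?thesis using cont[of i] that by (auto simp: continuous_map_def Pi_iff)
  qed
  have "\<exists>U V. openin (top_of_set {0..1}) U \<and> openin ?F V \<and> \<tau> \<in> U \<and> q \<in> V \<and>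
      U \<times> V \<subseteq> {p \<in> {0..1} \<times> S. (case p of (\<tau>, q) \<Rightarrow> k \<tau> q) \<in> W}"
    if W: "openin Z W" and \<tau>: "\<tau> \<in> {0..1}" and q: "q \<in> S" and kW: "k \<tau> q \<in> W" for W \<tau> q
  proof -
    obtain i a where i: "i \<in> I" "a \<in> topspace (T i)" "q = f i a" using S[OF q] by blast
    have "continuous_map (top_of_set {0..1}) (prod_topology (top_of_set {0..1}) (T i)) (\<lambda>\<tau>. (\<tau>, a))"
      using i by (intro continuous_map_pairedI) auto
    from continuous_map_compose[OF this cont[OF i(1)]]
    have "continuous_map (top_of_set {0..1}) Z (\<lambda>\<tau>. k \<tau> q)"
      by (simp add: o_def i)
    then have "openin (top_of_set {0..1}) {\<sigma> \<in> {0..1}. k \<sigma> q \<in> W}"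
      using W by (auto simp: continuous_map_def)
    then obtain e where e: "e > 0" "\<And>\<sigma>. \<sigma> \<in> {0..1} \<Longrightarrow> dist \<sigma> \<tau> < e \<Longrightarrow> k \<sigma> q \<in> W"
      unfolding openin_euclidean_subtopology_iff using \<tau> kW by blast
    \<comment> \<open>Half the radius, so that \<open>J\<close> is compact and \<open>k \<sigma> q \<in> W\<close> on all of \<open>J\<close>.\<close>
    define J where "J = {0..1} \<inter> cball \<tau> (e / 2)"
    define U where "U = {0..1} \<inter> ball \<tau> (e / 2)"
    define V where "V = {q \<in> S. \<forall>\<sigma>\<in>J. k \<sigma> q \<in> W}"
    have J: "J \<subseteq> {0..1}" "compact J" by (auto simp: J_def intro: compact_Int_closed)
    have "openin (top_of_set {0..1}) U" by (auto simp: U_def openin_open)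
    moreover have "\<tau> \<in> U" using e \<tau> by (simp add: U_def)
    moreover have "q \<in> V" using e q by (auto simp: V_def J_def dist_commute)
    moreover have "U \<times> V \<subseteq> {p \<in> {0..1} \<times> S. (case p of (\<tau>, q) \<Rightarrow> k \<tau> q) \<in> W}"
      by (auto simp: U_def V_def J_def)
    moreover have "openin ?F V"
      unfolding openin_final_topology
    proof (intro conjI ballI)
      show "V \<subseteq> S" by (auto simp: V_def)
      fix j assume j: "j \<in> I"
      let ?P = "prod_topology (top_of_set J) (T j)"
      have "continuous_map ?P (prod_topology (top_of_set {0..1}) (T j)) (\<lambda>p. p)"
        using J by (auto simp: prod_topology_subtopology continuous_map_in_subtopology
            intro: continuous_map_from_subtopology)
      from continuous_map_compose[OF this cont[OF j]]
      have c: "continuous_map ?P Z (\<lambda>(\<tau>, a). k \<tau> (f j a))" by (simp add: o_def)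
      have "closedin ?P {p \<in> topspace ?P. (\<lambda>(\<tau>, a). k \<tau> (f j a)) p \<in> topspace Z - W}"
        by (rule closedin_continuous_map_preimage[OF c]) (use W in blast)
      moreover have "closed_map ?P (T j) snd"
        using J by (intro Abstract_Topological_Spaces.closed_map_snd) (simp add: compact_space_subtopology)
      ultimately have "closedin (T j)
          (snd ` {p \<in> topspace ?P. (\<lambda>(\<tau>, a). k \<tau> (f j a)) p \<in> topspace Z - W})"
        by (simp add: closed_map_def)
      moreover have "snd ` {p \<in> topspace ?P. (\<lambda>(\<tau>, a). k \<tau> (f j a)) p \<in> topspace Z - W}
          = {a \<in> topspace (T j). \<exists>\<sigma>\<in>J. k \<sigma> (f j a) \<in> topspace Z - W}"
        by (auto simp: image_iff)
      moreover have "{a \<in> topspace (T j). f j a \<in> V} = topspace (T j) -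
          {a \<in> topspace (T j). \<exists>\<sigma>\<in>J. k \<sigma> (f j a) \<in> topspace Z - W}"
        using f[OF j] kZ J(1) by (auto simp: V_def Pi_iff subset_iff)
      ultimately show "openin (T j) {a \<in> topspace (T j). f j a \<in> V}" by auto
    qed
    ultimately show ?thesis by blast
  qed
  then have "openin (prod_topology (top_of_set {0..1}) ?F)
      {p \<in> {0..1} \<times> S. (case p of (\<tau>, q) \<Rightarrow> k \<tau> q) \<in> W}" if "openin Z W" for W
    unfolding openin_prod_topology_alt using that by auto
  then show ?thesis
    using kZ by (auto simp: continuous_map_def topF)
qed

lemma continuous_map_second_factor:
  assumes g: "continuous_on A g" "g ` A \<subseteq> B"
    and k: "continuous_map (top_of_set (K \<times> B)) Z (\<lambda>(\<tau>, a). k \<tau> a)"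
  shows "continuous_map (top_of_set (K \<times> A)) Z (\<lambda>(\<tau>, a). k \<tau> (g a))"
proof -
  have "continuous_on (K \<times> A) (\<lambda>p. (fst p, g (snd p)))"
    by (intro continuous_on_Pair continuous_on_fst continuous_on_id
        continuous_on_compose2[OF g(1)] continuous_on_snd) auto
  then have "continuous_map (top_of_set (K \<times> A)) (top_of_set (K \<times> B)) (\<lambda>p. (fst p, g (snd p)))"
    using g(2) by (auto simp: continuous_map_in_subtopology)
  from continuous_map_compose[OF this k] show ?thesis
    by (simp add: o_def case_prod_unfold)
qed

lemma continuous_map_snd_factor:
  assumes "continuous_map (top_of_set A) Z g"
  shows "continuous_map (top_of_set (K \<times> A)) Z (\<lambda>(\<tau>, a). g a)"
proof -
  have "continuous_map (top_of_set (K \<times> A)) (top_of_set A) snd"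
    by (auto simp: continuous_map_in_subtopology intro: continuous_on_snd continuous_on_id)
  from continuous_map_compose[OF this assms] show ?thesis by (simp add: o_def case_prod_unfold)
qed

lemma continuous_on_Min_image:
  fixes f :: "'i \<Rightarrow> 'b::topological_space \<Rightarrow> real"
  assumes "finite I" "I \<noteq> {}" "\<And>i. i \<in> I \<Longrightarrow> continuous_on A (f i)"
  shows "continuous_on A (\<lambda>a. Min ((\<lambda>i. f i a) ` I))"
  using assms
proof (induction I rule: finite_ne_induct)
  case (insert j F)
  have "continuous_on A (\<lambda>a. min (f j a) (Min ((\<lambda>i. f i a) ` F)))"
    using insert by (intro continuous_on_min) auto
  then show ?case using insert by simp
qed auto

lemma continuous_on_coord: "continuous_on A (\<lambda>a :: nat \<Rightarrow> real. a i)"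
  by (rule continuous_on_subset[OF continuous_on_product_coordinates]) simp


section \<open>Strong deformation retracts and weak homotopy equivalences\<close>

lemma sphere_class_eqI:
  assumes "homotopic_with (\<lambda>q. \<forall>t\<in>cube_boundary n. q t = x) (cube n) Y g g'"
  shows "sphere_class n Y x g = sphere_class n Y x g'"
  using assms homotopic_with_trans homotopic_with_sym unfolding sphere_class_def by blast

lemma sphere_class_refl:
  "continuous_map (cube n) Y g \<Longrightarrow> \<forall>t\<in>cube_boundary n. g t = x \<Longrightarrow> g \<in> sphere_class n Y x g"
  by (simp add: sphere_class_def)

text \<open>The induced map on homotopy classes is composition with \<open>f\<close> on representatives; the union in its
  definition runs over equal classes.\<close>
lemma homotopy_group_map_class:
  assumes f: "continuous_map A Y f" and g: "continuous_map (cube n) A g" "\<forall>t\<in>cube_boundary n. g t = x"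
  shows "homotopy_group_map n Y f x (sphere_class n A x g) = sphere_class n Y (f x) (f \<circ> g)"
proof -
  have "sphere_class n Y (f x) (f \<circ> h) = sphere_class n Y (f x) (f \<circ> g)" if "h \<in> sphere_class n A x g" for h
  proof -
    have "homotopic_with (\<lambda>q. \<forall>t\<in>cube_boundary n. q t = f x) (cube n) Y (f \<circ> g) (f \<circ> h)"
      using that unfolding sphere_class_def
      by (auto intro: homotopic_with_compose_continuous_map_left[OF _ f])
    then show ?thesis by (rule sphere_class_eqI[symmetric])
  qed
  then show ?thesis
    using sphere_class_refl[OF g] unfolding homotopy_group_map_def by blast
qed

lemma path_component_of_map:
  assumes "continuous_map A Y f" "path_component_of A a b"
  shows "path_component_of Y (f a) (f b)"
proof -
  obtain g where "pathin A g" "g 0 = a" "g 1 = b" using assms(2) by (auto simp: path_component_of_def)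
  then have "pathin Y (f \<circ> g)" "(f \<circ> g) 0 = f a" "(f \<circ> g) 1 = f b"
    using assms(1) by (auto intro: pathin_compose)
  then show ?thesis unfolding path_component_of_def by blast
qed

lemma path_component_of_set_eq:
  "path_component_of Z u w \<Longrightarrow> path_component_of_set Z u = path_component_of_set Z w"
  by (simp add: path_component_of_equiv)

text \<open>Since the homotopy \<open>h\<close> fixes the image of \<open>f\<close> pointwise, it can be applied to maps of
  cubes with boundary at a base point \<open>f x\<close>, without change of base point.\<close>
lemma strong_deformation_retract_imp_weak_homotopy_equivalence:
  fixes h :: "real \<Rightarrow> 'b \<Rightarrow> 'b"
  assumes f: "continuous_map A Y f" and r: "continuous_map Y A r"
    and h: "continuous_map (prod_topology (top_of_set {0..1}) Y) Y (\<lambda>(\<tau>, y). h \<tau> y)"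
    and rf: "\<And>a. a \<in> topspace A \<Longrightarrow> r (f a) = a"
    and h0: "\<And>y. y \<in> topspace Y \<Longrightarrow> h 0 y = y"
    and h1: "\<And>y. y \<in> topspace Y \<Longrightarrow> h 1 y = f (r y)"
    and hf: "\<And>\<tau> a. a \<in> topspace A \<Longrightarrow> h \<tau> (f a) = f a"
  shows "weak_homotopy_equivalence A Y f"
  unfolding weak_homotopy_equivalence_def
proof (intro conjI allI impI ballI f)
  have fA: "f a \<in> topspace Y" if "a \<in> topspace A" for a
    using continuous_map_image_subset_topspace[OF f] that by auto
  have rY: "r y \<in> topspace A" if "y \<in> topspace Y" for y
    using continuous_map_image_subset_topspace[OF r] that by auto
  let ?\<pi> = "\<lambda>C. \<Union>x\<in>C. path_component_of_set Y (f x)"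
  have \<pi>: "?\<pi> (path_component_of_set A a) = path_component_of_set Y (f a)" if a: "a \<in> topspace A" for a
  proof (rule SUP_eq_const)
    have "a \<in> path_component_of_set A a" using a path_component_of_refl[of A a] by simp
    then show "path_component_of_set A a \<noteq> {}" by blast
    fix x assume "x \<in> path_component_of_set A a"
    then have "path_component_of A a x" by simp
    then show "path_component_of_set Y (f x) = path_component_of_set Y (f a)"
      by (rule path_component_of_set_eq[OF path_component_of_map[OF f], symmetric])
  qed
  show "bij_betw ?\<pi> (path_components_of A) (path_components_of Y)"
  proof (rule bij_betw_imageI)
    show "inj_on ?\<pi> (path_components_of A)"
    proof (rule inj_onI)
      fix C D assume "C \<in> path_components_of A" "D \<in> path_components_of A" and eq: "?\<pi> C = ?\<pi> D"
      then obtain a b where ab: "a \<in> topspace A" "C = path_component_of_set A a"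
          "b \<in> topspace A" "D = path_component_of_set A b" by (auto simp: path_components_of_def)
      then have "path_component_of_set Y (f a) = path_component_of_set Y (f b)" using eq \<pi> by simp
      then have "path_component_of Y (f a) (f b)"
        using fA[OF ab(3)] path_component_of_refl[of Y "f b"] by blast
      then have "path_component_of A a b"
        using path_component_of_map[OF r, of "f a" "f b"] rf ab by simp
      then show "C = D" unfolding ab(2,4) by (rule path_component_of_set_eq)
    qed
    have surj: "path_component_of_set Y y = ?\<pi> (path_component_of_set A (r y))" if y: "y \<in> topspace Y" for y
    proof -
      \<comment> \<open>Every point is joined to the image of \<open>f\<close> by its track under the homotopy.\<close>
      have "continuous_map (top_of_set {0..1}) (prod_topology (top_of_set {0..1}) Y) (\<lambda>\<tau>::real. (\<tau>, y))"
        using y by (intro continuous_map_pairedI) auto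
      from continuous_map_compose[OF this h] have "pathin Y (\<lambda>\<tau>. h \<tau> y)"
        by (simp add: pathin_def o_def)
      then have "path_component_of Y y (f (r y))"
        unfolding path_component_of_def using h0[OF y] h1[OF y] by blast
      then show ?thesis unfolding \<pi>[OF rY[OF y]] by (rule path_component_of_set_eq)
    qed
    show "?\<pi> ` path_components_of A = path_components_of Y"
    proof (intro equalityI subsetI)
      fix D assume "D \<in> ?\<pi> ` path_components_of A"
      then obtain a where a: "a \<in> topspace A" "D = ?\<pi> (path_component_of_set A a)"
        by (auto simp: path_components_of_def)
      then show "D \<in> path_components_of Y"
        unfolding a(2) \<pi>[OF a(1)] path_components_of_def using fA by blast
    next
      fix D assume "D \<in> path_components_of Y"
      then obtain y where y: "y \<in> topspace Y" "D = path_component_of_set Y y"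
        by (auto simp: path_components_of_def)
      then show "D \<in> ?\<pi> ` path_components_of A"
        unfolding y(2) surj[OF y(1)] path_components_of_def using rY by blast
    qed
  qed
  fix n :: nat and x assume x: "x \<in> topspace A"
  let ?P = "\<lambda>z q. \<forall>t\<in>cube_boundary n. q t = z"
  have bd_cong: "?P z p \<longleftrightarrow> ?P z q" if "\<And>t. t \<in> topspace (cube n) \<Longrightarrow> p t = q t" for z :: 'c and p q
    using that by (simp add: cube_boundary_def)
  note map = homotopy_group_map_class[OF f]
  show "bij_betw (homotopy_group_map n Y f x) (homotopy_group n A x) (homotopy_group n Y (f x))"
  proof (rule bij_betw_imageI)
    show "inj_on (homotopy_group_map n Y f x) (homotopy_group n A x)"
    proof (rule inj_onI)
      fix C D assume "C \<in> homotopy_group n A x" "D \<in> homotopy_group n A x"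
        and eq: "homotopy_group_map n Y f x C = homotopy_group_map n Y f x D"
      then obtain g g' where g: "C = sphere_class n A x g" "continuous_map (cube n) A g" "?P x g"
        and g': "D = sphere_class n A x g'" "continuous_map (cube n) A g'" "?P x g'"
        by (auto simp: homotopy_group_def)
      have "sphere_class n Y (f x) (f \<circ> g) = sphere_class n Y (f x) (f \<circ> g')"
        using eq map[OF g(2,3)] map[OF g'(2,3)] by (simp add: g(1) g'(1))
      moreover have "f \<circ> g' \<in> sphere_class n Y (f x) (f \<circ> g')"
        using continuous_map_compose[OF g'(2) f] g'(3) by (intro sphere_class_refl) auto
      ultimately have "f \<circ> g' \<in> sphere_class n Y (f x) (f \<circ> g)" by simp
      then have "homotopic_with (?P (f x)) (cube n) Y (f \<circ> g) (f \<circ> g')"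
        by (simp add: sphere_class_def)
      then have "homotopic_with (?P x) (cube n) A (r \<circ> (f \<circ> g)) (r \<circ> (f \<circ> g'))"
        by (rule homotopic_with_compose_continuous_map_left[OF _ r]) (simp add: rf x)
      then have "homotopic_with (?P x) (cube n) A g g'"
      proof (rule homotopic_with_eq)
        show "g t = (r \<circ> (f \<circ> g)) t" "g' t = (r \<circ> (f \<circ> g')) t" if "t \<in> topspace (cube n)" for t
          using continuous_map_image_subset_topspace[OF g(2)]
            continuous_map_image_subset_topspace[OF g'(2)] that by (auto simp: rf)
      qed (rule bd_cong)
      then show "C = D" unfolding g(1) g'(1) by (rule sphere_class_eqI)
    qed
    have "homotopy_group_map n Y f x C \<in> homotopy_group n Y (f x)" if C: "C \<in> homotopy_group n A x" for C
    proof -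
      obtain g where g: "C = sphere_class n A x g" "continuous_map (cube n) A g" "?P x g"
        using C by (auto simp: homotopy_group_def)
      then show ?thesis
        using map[OF g(2,3)] continuous_map_compose[OF g(2) f] by (auto simp: homotopy_group_def)
    qed
    moreover have "\<exists>C\<in>homotopy_group n A x. homotopy_group_map n Y f x C = D"
      if D: "D \<in> homotopy_group n Y (f x)" for D
    proof -
      obtain g where g: "D = sphere_class n Y (f x) g" "continuous_map (cube n) Y g" "?P (f x) g"
        using D by (auto simp: homotopy_group_def)
      have gY: "g t \<in> topspace Y" if "t \<in> topspace (cube n)" for t
        using continuous_map_image_subset_topspace[OF g(2)] that by auto
      have rg: "continuous_map (cube n) A (r \<circ> g)" "?P x (r \<circ> g)"
        using continuous_map_compose[OF g(2) r] g(3) rf x by auto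
      have "continuous_map (prod_topology (top_of_set {0..1}) (cube n))
          (prod_topology (top_of_set {0..1}) Y) (\<lambda>p. (fst p, g (snd p)))"
        using continuous_map_compose[OF continuous_map_snd g(2)]
        by (intro continuous_map_pairedI) (auto simp: o_def continuous_map_fst)
      from continuous_map_compose[OF this h]
      have "continuous_map (prod_topology (top_of_set {0..1}) (cube n)) Y (\<lambda>p. h (fst p) (g (snd p)))"
        by (simp add: o_def)
      then have "homotopic_with (?P (f x)) (cube n) Y (\<lambda>t. h 0 (g t)) (\<lambda>t. h 1 (g t))"
        unfolding homotopic_with_def
        by (intro exI[of _ "\<lambda>p. h (fst p) (g (snd p))"]) (use g(3) hf[OF x] in auto)
      then have hom: "homotopic_with (?P (f x)) (cube n) Y g (f \<circ> (r \<circ> g))"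
      proof (rule homotopic_with_eq)
        show "g t = h 0 (g t)" "(f \<circ> (r \<circ> g)) t = h 1 (g t)" if "t \<in> topspace (cube n)" for t
          using gY[OF that] by (simp_all add: h0 h1)
      qed (rule bd_cong)
      have "homotopy_group_map n Y f x (sphere_class n A x (r \<circ> g)) = sphere_class n Y (f x) (f \<circ> (r \<circ> g))"
        by (rule map[OF rg])
      also have "\<dots> = D" unfolding g(1) by (rule sphere_class_eqI[OF hom, symmetric])
      finally have "homotopy_group_map n Y f x (sphere_class n A x (r \<circ> g)) = D" .
      moreover have "sphere_class n A x (r \<circ> g) \<in> homotopy_group n A x"
        unfolding homotopy_group_def using rg by blast
      ultimately show ?thesis by blast
    qed
    ultimately show "homotopy_group_map n Y f x ` homotopy_group n A x = homotopy_group n Y (f x)"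
      by blast
  qed
qed


section \<open>Cofaces, codegeneracies and affine simplices\<close>

text \<open>The injection \<open>[n] \<rightarrow> [n + 1]\<close> omitting \<open>i\<close>.\<close>
definition coface :: "nat \<Rightarrow> nat \<Rightarrow> nat \<Rightarrow> nat" where
  "coface n i = (\<lambda>k\<in>{..n}. if k < i then k else Suc k)"

text \<open>The surjection \<open>[n + 1] \<rightarrow> [n]\<close> taking the value \<open>j\<close> twice.\<close>
definition codegen :: "nat \<Rightarrow> nat \<Rightarrow> nat \<Rightarrow> nat" where
  "codegen n j = (\<lambda>k\<in>{..Suc n}. if k \<le> j then k else k - 1)"

lemma coface_in_simplex_maps: "coface n i \<in> simplex_maps n (Suc n)"
  by (auto simp: simplex_maps_def coface_def mono_on_def)

lemma codegen_in_simplex_maps: "j \<le> n \<Longrightarrow> codegen n j \<in> simplex_maps (Suc n) n"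
  by (auto simp: simplex_maps_def codegen_def mono_on_def)

lemma coface_coface:
  "i < j \<Longrightarrow> compose {..n} (coface (Suc n) j) (coface n i)
     = compose {..n} (coface (Suc n) i) (coface n (j - 1))"
  by (auto simp: compose_def coface_def fun_eq_iff restrict_def)

lemma codegen_coface_same:
  "i = j \<or> i = Suc j \<Longrightarrow> compose {..n} (codegen n j) (coface n i) = (\<lambda>k\<in>{..n}. k)"
  by (auto simp: compose_def coface_def codegen_def fun_eq_iff restrict_def)

lemma codegen_coface_less:
  "i < j \<Longrightarrow> j \<le> Suc n \<Longrightarrow> compose {..Suc n} (codegen (Suc n) j) (coface (Suc n) i)
     = compose {..Suc n} (coface n i) (codegen n (j - 1))"
  by (auto simp: compose_def coface_def codegen_def fun_eq_iff restrict_def)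

lemma codegen_coface_greater:
  "Suc j < i \<Longrightarrow> i \<le> Suc (Suc n) \<Longrightarrow> compose {..Suc n} (codegen (Suc n) j) (coface (Suc n) i)
     = compose {..Suc n} (coface n (i - 1)) (codegen n j)"
  by (auto simp: compose_def coface_def codegen_def fun_eq_iff restrict_def)

lemma simplex_mapsD:
  assumes "f \<in> simplex_maps m n"
  shows "i \<le> m \<Longrightarrow> f i \<le> n" "i \<le> j \<Longrightarrow> j \<le> m \<Longrightarrow> f i \<le> f j" "f \<in> extensional {..m}"
  using assms by (auto simp: simplex_maps_def mono_on_def PiE_def)

text \<open>Every morphism of the simplex category is an identity, or factors through a coface on the left
  (if it is not surjective), or through a codegeneracy on the right (if it is not injective).\<close>
lemma simplex_maps_cases [consumes 1, case_names id coface codegen]: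
  assumes f: "f \<in> simplex_maps m n"
  obtains "m = n" "f = (\<lambda>k\<in>{..n}. k)"
    | i n' g where "n = Suc n'" "i \<le> n" "g \<in> simplex_maps m n'" "f = compose {..m} (coface n' i) g"
    | j m' g where "m = Suc m'" "j \<le> m'" "g \<in> simplex_maps m' n" "f = compose {..m} g (codegen m' j)"
proof (cases "\<exists>j. j < m \<and> f j = f (Suc j)")
  case True
  then obtain j where j: "j < m" "f j = f (Suc j)" by blast
  then obtain m' where m: "m = Suc m'" by (cases m) auto
  define g where "g = (\<lambda>k\<in>{..m'}. if k \<le> j then f k else f (Suc k))"
  have "g \<in> simplex_maps m' n"
    using simplex_mapsD[OF f] m by (auto simp: simplex_maps_def mono_on_def g_def)
  moreover have "f = compose {..m} g (codegen m' j)"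
  proof
    fix k
    show "f k = compose {..m} g (codegen m' j) k"
    proof (cases "k \<le> m")
      case True
      consider "k \<le> j" | "k = Suc j" | "Suc j < k" by linarith
      then show ?thesis using True m j
        by cases (auto simp: compose_def g_def codegen_def)
    next
      case False
      then show ?thesis using simplex_mapsD(3)[OF f] by (auto simp: compose_def extensional_def)
    qed
  qed
  ultimately show thesis using that(3)[of m' j g] m j by auto
next
  case False
  have inj: "f j < f (Suc j)" if "j < m" for j
    using simplex_mapsD(2)[OF f, of j "Suc j"] False that by (auto simp: order_less_le)
  have less: "f j < f k" if "j < k" "k \<le> m" for j k
    using that
  proof (induction k)
    case (Suc k)
    then show ?case using inj[of k] by (cases "j = k") auto
  qed auto
  have ge: "k \<le> f k" if "k \<le> m" for k
    using that by (induction k) (auto dest!: inj simp: Suc_le_eq)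
  show thesis
  proof (cases "\<exists>i\<le>n. \<forall>k\<le>m. f k \<noteq> i")
    case True
    then obtain i where i: "i \<le> n" "\<And>k. k \<le> m \<Longrightarrow> f k \<noteq> i" by blast
    have "n \<noteq> 0" using i(1) i(2)[of 0] simplex_mapsD(1)[OF f, of 0] by (cases n) auto
    then obtain n' where n: "n = Suc n'" by (cases n) auto
    define g where "g = (\<lambda>k\<in>{..m}. if f k < i then f k else f k - 1)"
    have "g \<in> simplex_maps m n'"
    proof -
      have "f k < i \<Longrightarrow> f k \<le> n'" for k using i n by auto
      moreover have "f k - 1 \<le> n'" if "k \<le> m" for k using simplex_mapsD(1)[OF f that] n by auto
      moreover have "g k \<le> g l" if "k \<le> l" "l \<le> m" for k l
        using simplex_mapsD(2)[OF f that] that by (auto simp: g_def)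
      ultimately show ?thesis by (auto simp: simplex_maps_def mono_on_def g_def)
    qed
    moreover have "f = compose {..m} (coface n' i) g"
    proof
      fix k
      show "f k = compose {..m} (coface n' i) g k"
      proof (cases "k \<le> m")
        case True
        then have "g k \<le> n'" using \<open>g \<in> simplex_maps m n'\<close> simplex_mapsD(1) by blast
        then show ?thesis using True i(2)[OF True] 
          by (auto simp: compose_def g_def coface_def)
      next
        case False
        then show ?thesis using simplex_mapsD(3)[OF f] by (auto simp: compose_def extensional_def)
      qed
    qed
    ultimately show thesis using that(2)[of n' i g] n i by auto
  next
    case False
    \<comment> \<open>Each \<open>k \<le> m\<close> is a value \<open>f l\<close>, and \<open>l \<le> f l\<close> since \<open>f\<close> is strictly increasing.\<close>
    have id: "f k = k" if "k \<le> m" for k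
      using that
    proof (induction k rule: less_induct)
      case (less k)
      obtain l where l: "l \<le> m" "f l = k"
        using False simplex_mapsD(1)[OF f less.prems] ge[OF less.prems] by (meson le_trans)
      have "l \<le> k" using ge[OF l(1)] l(2) by simp
      moreover have "\<not> l < k" using less.IH[of l] l by auto
      ultimately show ?case using l by auto
    qed
    have "m = n"
    proof -
      obtain l where "l \<le> m" "f l = n" using False by blast
      then show ?thesis using id[of l] id[of m] simplex_mapsD(1)[OF f, of m] by auto
    qed
    moreover have "f = (\<lambda>k\<in>{..n}. k)"
      using id simplex_mapsD(3)[OF f] \<open>m = n\<close> by (auto simp: fun_eq_iff extensional_def)
    ultimately show thesis by (rule that(1))
  qed
qed

lemma affine_simplex_iff:
  "a \<in> affine_simplex n \<longleftrightarrow> (\<forall>k>n. a k = 0) \<and> (\<Sum>k\<le>n. a k) = 1"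
  by (auto simp: affine_simplex_def topspace_Euclidean_space Suc_le_eq)

lemma standard_simplex_iff:
  "a \<in> standard_simplex n \<longleftrightarrow> a \<in> affine_simplex n \<and> (\<forall>k. 0 \<le> a k)"
proof
  assume "a \<in> affine_simplex n \<and> (\<forall>k. 0 \<le> a k)"
  then have a: "\<forall>k>n. a k = 0" "(\<Sum>k\<le>n. a k) = 1" "\<forall>k. 0 \<le> a k"
    by (auto simp: affine_simplex_iff)
  have "a k \<le> 1" for k
  proof (cases "k \<le> n")
    case True
    then have "a k \<le> (\<Sum>k\<le>n. a k)" using a(3) by (intro member_le_sum) auto
    then show ?thesis using a by simp
  qed (use a in auto)
  then show "a \<in> standard_simplex n" using a by (auto simp: standard_simplex_def)
qed (auto simp: standard_simplex_def affine_simplex_iff)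

lemma standard_subset_affine: "standard_simplex n \<subseteq> affine_simplex n"
  by (auto simp: standard_simplex_iff)

lemma affine_simplex_0: "affine_simplex 0 = standard_simplex 0"
proof -
  have "0 \<le> a k" if "a \<in> affine_simplex 0" for a k
    using that by (cases k) (auto simp: affine_simplex_iff)
  then show ?thesis by (auto simp: standard_simplex_iff)
qed

lemma closed_affine_simplex: "closed (affine_simplex n)"
proof -
  have "affine_simplex n = (\<Inter>k\<in>{n<..}. {a. a k = 0}) \<inter> {a. (\<Sum>k\<le>n. a k) = 1}"
    by (auto simp: affine_simplex_iff)
  then show ?thesis
    by (auto intro!: closed_Int closed_INT closed_Collect_eq continuous_on_sum continuous_on_coord
        continuous_on_const)
qed

lemma closed_standard_simplex: "closed (standard_simplex n)"
  using closedin_standard_simplex[of n] by (simp add: euclidean_product_topology)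

text \<open>On coordinates: omit the \<open>i\<close>-th one. On the hyperplane \<open>a\<^sub>i = 0\<close> this inverts the
  map induced by the coface \<open>i\<close>.\<close>
definition delete_coord :: "nat \<Rightarrow> (nat \<Rightarrow> real) \<Rightarrow> nat \<Rightarrow> real" where
  "delete_coord i a = (\<lambda>k. if k < i then a k else a (Suc k))"

text \<open>On coordinates: replace the coordinates \<open>j\<close> and \<open>j + 1\<close> by their sum, which is the map induced
  by the codegeneracy \<open>j\<close>.\<close>
definition merge_coords :: "nat \<Rightarrow> (nat \<Rightarrow> real) \<Rightarrow> nat \<Rightarrow> real" where
  "merge_coords j a = (\<lambda>k. if k < j then a k else if k = j then a j + a (Suc j) else a (Suc k))"

lemma delete_delete: "i < j \<Longrightarrow> delete_coord i (delete_coord j a) = delete_coord (j - 1) (delete_coord i a)"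
  by (auto simp: delete_coord_def fun_eq_iff)

lemma merge_merge: "i < j \<Longrightarrow> merge_coords i (merge_coords j a) = merge_coords (j - 1) (merge_coords i a)"
  by (auto simp: merge_coords_def fun_eq_iff)

lemma delete_eq_merge: "a i = 0 \<Longrightarrow> i = j \<or> i = Suc j \<Longrightarrow> delete_coord i a = merge_coords j a"
  by (auto simp: merge_coords_def delete_coord_def fun_eq_iff not_less)

lemma delete_merge_less: "i < j \<Longrightarrow> delete_coord i (merge_coords j a) = merge_coords (j - 1) (delete_coord i a)"
  by (auto simp: merge_coords_def delete_coord_def fun_eq_iff)

lemma delete_merge_greater: "Suc j < i \<Longrightarrow> delete_coord (i - 1) (merge_coords j a) = merge_coords j (delete_coord i a)"
  by (auto simp: merge_coords_def delete_coord_def fun_eq_iff)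

lemma continuous_on_delete_coord: "continuous_on A (delete_coord i)"
proof -
  have "continuous_on A (\<lambda>a. delete_coord i a k)" for k
    unfolding delete_coord_def by (cases "k < i") (simp_all add: continuous_on_coord)
  then show ?thesis by (intro continuous_on_coordinatewise_then_product)
qed

lemma continuous_on_merge_coords: "continuous_on A (merge_coords j)"
proof -
  have "continuous_on A (\<lambda>a. merge_coords j a k)" for k
    unfolding merge_coords_def
    by (cases "k < j"; cases "k = j") (auto intro!: continuous_on_add continuous_on_coord)
  then show ?thesis by (intro continuous_on_coordinatewise_then_product)
qed

lemma sum_delete_coord:
  assumes "a i = 0" "i \<le> Suc n"
  shows "(\<Sum>k\<le>n. delete_coord i a k) = (\<Sum>k\<le>Suc n. a k)"
proof -
  have "(\<Sum>k\<le>Suc n. a k) = (\<Sum>k\<in>{..Suc n} - {i}. a k)"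
    using assms by (subst sum.remove[of _ i]) auto
  also have "\<dots> = (\<Sum>k\<le>n. delete_coord i a k)"
    by (rule sum.reindex_bij_witness[where i = "\<lambda>k. if k < i then k else Suc k"
          and j = "\<lambda>k. if k < i then k else k - 1"])
      (use assms in \<open>auto simp: delete_coord_def\<close>)
  finally show ?thesis by simp
qed

lemma delete_in_affine:
  "a \<in> affine_simplex (Suc n) \<Longrightarrow> a i = 0 \<Longrightarrow> i \<le> Suc n \<Longrightarrow> delete_coord i a \<in> affine_simplex n"
  using sum_delete_coord[of a i n] by (auto simp: affine_simplex_iff delete_coord_def)

lemma push_coords_coface:
  assumes "b \<in> affine_simplex n" "i \<le> Suc n"
  shows "push_coords n (coface n i) b = (\<lambda>k. if k < i then b k else if k = i then 0 else b (k - 1))"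
proof
  fix k
  have z: "b k = 0" if "k > n" for k using assms(1) that by (auto simp: affine_simplex_iff)
  have "{l. l \<le> n \<and> coface n i l = k} =
      (if k < i then {k} \<inter> {..n} else if k = i then {} else {k - 1} \<inter> {..n})"
    by (auto simp: coface_def)
  then show "push_coords n (coface n i) b k = (if k < i then b k else if k = i then 0 else b (k - 1))"
    using z by (auto simp: push_coords_def Int_insert_left not_le)
qed

lemma push_coords_coface_delete:
  assumes "a \<in> affine_simplex (Suc n)" "a i = 0" "i \<le> Suc n"
  shows "push_coords n (coface n i) (delete_coord i a) = a"
  using push_coords_coface[OF delete_in_affine[OF assms] assms(3)] assms(2)
  by (auto simp: fun_eq_iff delete_coord_def)

lemma delete_push_coords_coface:
  assumes "b \<in> affine_simplex n" "i \<le> Suc n"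
  shows "delete_coord i (push_coords n (coface n i) b) = b" "push_coords n (coface n i) b i = 0"
  using push_coords_coface[OF assms] by (auto simp: fun_eq_iff delete_coord_def)

lemma push_coords_in_affine:
  assumes "f \<in> simplex_maps m n" "a \<in> affine_simplex m"
  shows "push_coords m f a \<in> affine_simplex n"
proof -
  have f: "\<And>i. i \<le> m \<Longrightarrow> f i \<le> n" using assms(1) by (auto simp: simplex_maps_def)
  have "(\<Sum>k\<le>n. push_coords m f a k) = (\<Sum>i\<le>m. a i)"
    unfolding push_coords_def
    using sum.group[of "{..m}" "{..n}" f a] f by (simp add: image_subset_iff)
  moreover have "push_coords m f a k = 0" if "k > n" for k
  proof -
    have "{i. i \<le> m \<and> f i = k} = {}" using f that by force
    then show ?thesis unfolding push_coords_def by (simp only: sum.empty)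
  qed
  ultimately show ?thesis using assms(2) by (auto simp: affine_simplex_iff)
qed

lemma push_coords_codegen:
  assumes "a \<in> affine_simplex (Suc n)" "j \<le> n"
  shows "push_coords (Suc n) (codegen n j) a = merge_coords j a"
proof
  fix k
  have z: "a k = 0" if "k > Suc n" for k using assms(1) that by (auto simp: affine_simplex_iff)
  have "{l. l \<le> Suc n \<and> codegen n j l = k} =
      (if k < j then {k} else if k = j then {j, Suc j} else {Suc k} \<inter> {..Suc n})"
    using assms(2) by (auto simp: codegen_def split: if_splits)
  then show "push_coords (Suc n) (codegen n j) a k = merge_coords j a k"
    using z by (auto simp: push_coords_def merge_coords_def Int_insert_left)
qed

lemma merge_in_affine:
  "a \<in> affine_simplex (Suc n) \<Longrightarrow> j \<le> n \<Longrightarrow> merge_coords j a \<in> affine_simplex n"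
  using push_coords_in_affine[OF codegen_in_simplex_maps] push_coords_codegen by metis

lemma merge_in_standard:
  "a \<in> standard_simplex (Suc n) \<Longrightarrow> j \<le> n \<Longrightarrow> merge_coords j a \<in> standard_simplex n"
  using merge_in_affine by (auto simp: standard_simplex_iff merge_coords_def)

lemma delete_in_standard:
  "a \<in> standard_simplex (Suc n) \<Longrightarrow> a i = 0 \<Longrightarrow> i \<le> Suc n \<Longrightarrow> delete_coord i a \<in> standard_simplex n"
  using delete_in_affine by (auto simp: standard_simplex_iff delete_coord_def)

lemma push_coords_compose:
  assumes "f \<in> simplex_maps l m"
  shows "push_coords l (compose {..l} g f) a = push_coords m g (push_coords l f a)"
proof
  fix k
  have f: "\<And>i. i \<le> l \<Longrightarrow> f i \<le> m" using assms by (auto simp: simplex_maps_def)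
  have "push_coords m g (push_coords l f a) k
      = (\<Sum>j\<in>{j. j \<le> m \<and> g j = k}. \<Sum>i\<in>{i \<in> {i. i \<le> l \<and> g (f i) = k}. f i = j}. a i)"
    unfolding push_coords_def by (intro sum.cong) auto
  also have "\<dots> = (\<Sum>i\<in>{i. i \<le> l \<and> g (f i) = k}. a i)"
    by (rule sum.group) (use f in auto)
  finally show "push_coords l (compose {..l} g f) a k = push_coords m g (push_coords l f a) k"
    by (auto simp: push_coords_def compose_def intro!: sum.cong)
qed

lemma push_coords_id:
  "a \<in> affine_simplex n \<Longrightarrow> push_coords n (\<lambda>k\<in>{..n}. k) a = a"
proof
  fix k assume a: "a \<in> affine_simplex n"
  have "{i. i \<le> n \<and> (\<lambda>k\<in>{..n}. k) i = k} = {k} \<inter> {..n}" by auto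
  then show "push_coords n (\<lambda>k\<in>{..n}. k) a k = a k"
    using a by (auto simp: push_coords_def affine_simplex_iff Int_insert_left not_le)
qed


section \<open>Faces and degeneracies of a simplicial set\<close>

lemma act_in:
  "simplicial_set X \<Longrightarrow> f \<in> simplex_maps m n \<Longrightarrow> x \<in> simplices X n \<Longrightarrow> act X m n f x \<in> simplices X m"
  unfolding simplicial_set_def by blast

lemma act_id:
  "simplicial_set X \<Longrightarrow> x \<in> simplices X n \<Longrightarrow> act X n n (\<lambda>i\<in>{..n}. i) x = x"
  unfolding simplicial_set_def by blast

lemma act_act:
  "simplicial_set X \<Longrightarrow> f \<in> simplex_maps l m \<Longrightarrow> g \<in> simplex_maps m n \<Longrightarrow> x \<in> simplices X n \<Longrightarrow>
     act X l m f (act X m n g x) = act X l n (compose {..l} g f) x"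
  unfolding simplicial_set_def by metis

text \<open>The \<open>i\<close>-th face of an \<open>(n + 1)\<close>-simplex.\<close>
definition face :: "'a simp_set \<Rightarrow> nat \<Rightarrow> nat \<Rightarrow> 'a \<Rightarrow> 'a" where
  "face X n i = act X n (Suc n) (coface n i)"

text \<open>The \<open>j\<close>-th degeneracy of an \<open>n\<close>-simplex.\<close>
definition degen :: "'a simp_set \<Rightarrow> nat \<Rightarrow> nat \<Rightarrow> 'a \<Rightarrow> 'a" where
  "degen X n j = act X (Suc n) n (codegen n j)"

context
  fixes X :: "'a simp_set"
  assumes X: "simplicial_set X"
begin

lemma face_in: "x \<in> simplices X (Suc n) \<Longrightarrow> face X n i x \<in> simplices X n"
  using act_in[OF X coface_in_simplex_maps] by (simp add: face_def)

lemma degen_in: "y \<in> simplices X n \<Longrightarrow> j \<le> n \<Longrightarrow> degen X n j y \<in> simplices X (Suc n)"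
  using act_in[OF X codegen_in_simplex_maps] by (simp add: degen_def)

lemma face_face:
  assumes "i < j" "x \<in> simplices X (Suc (Suc n))"
  shows "face X n i (face X (Suc n) j x) = face X n (j - 1) (face X (Suc n) i x)"
  unfolding face_def using assms
  by (simp add: act_act[OF X coface_in_simplex_maps coface_in_simplex_maps] coface_coface)

lemma face_degen_same:
  assumes "i = j \<or> i = Suc j" "j \<le> n" "y \<in> simplices X n"
  shows "face X n i (degen X n j y) = y"
  unfolding face_def degen_def using assms
  by (simp add: act_act[OF X coface_in_simplex_maps codegen_in_simplex_maps] codegen_coface_same
      act_id[OF X])

lemma face_degen_less:
  assumes "i < j" "j \<le> Suc n" "y \<in> simplices X (Suc n)"
  shows "face X (Suc n) i (degen X (Suc n) j y) = degen X n (j - 1) (face X n i y)"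
proof -
  have "j - 1 \<le> n" using assms by simp
  then show ?thesis unfolding face_def degen_def using assms
    by (simp add: act_act[OF X coface_in_simplex_maps codegen_in_simplex_maps]
        act_act[OF X codegen_in_simplex_maps coface_in_simplex_maps] codegen_coface_less)
qed

lemma face_degen_greater:
  assumes "Suc j < i" "i \<le> Suc (Suc n)" "y \<in> simplices X (Suc n)"
  shows "face X (Suc n) i (degen X (Suc n) j y) = degen X n j (face X n (i - 1) y)"
proof -
  have "j \<le> n" using assms by simp
  then show ?thesis unfolding face_def degen_def using assms
    by (simp add: act_act[OF X coface_in_simplex_maps codegen_in_simplex_maps]
        act_act[OF X codegen_in_simplex_maps coface_in_simplex_maps] codegen_coface_greater)
qed

text \<open>A simplex that is a degeneracy in two ways is a twofold degeneracy: the square of codegeneracies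
  that expresses \<open>s\<^sub>i s\<^sub>j = s\<^sub>j\<^sub>-\<^sub>1 s\<^sub>i\<close> is an absolute pushout.\<close>
lemma degen_eq_degen:
  assumes eq: "degen X (Suc n) i y = degen X (Suc n) j z" and ij: "i < j" "j \<le> Suc n"
    and yz: "y \<in> simplices X (Suc n)" "z \<in> simplices X (Suc n)"
  obtains w where "w \<in> simplices X n" "y = degen X n (j - 1) w" "z = degen X n i w"
proof
  let ?w = "face X n i z"
  show "?w \<in> simplices X n" by (rule face_in[OF yz(2)])
  show "y = degen X n (j - 1) ?w"
    using face_degen_same[of i i "Suc n" y] face_degen_less[of i j n z] eq ij yz by simp
  have x: "degen X (Suc n) j z \<in> simplices X (Suc (Suc n))" using degen_in[OF yz(2)] ij by simp
  have "z = face X (Suc n) (Suc j) (degen X (Suc n) j z)"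
    using face_degen_same[of "Suc j" j "Suc n" z] ij yz by simp
  also have "\<dots> = degen X n i (face X n j y)"
    using face_degen_greater[of i "Suc j" n y] ij yz eq by simp
  also have "face X n j y = face X n j (face X (Suc n) i (degen X (Suc n) j z))"
    using face_degen_same[of i i "Suc n" y] eq ij yz by simp
  also have "\<dots> = face X n i (face X (Suc n) (Suc j) (degen X (Suc n) j z))"
    using face_face[OF _ x, of i "Suc j"] ij by simp
  also have "\<dots> = ?w"
    using face_degen_same[of "Suc j" j "Suc n" z] ij yz by simp
  finally show "z = degen X n i ?w" .
qed

end


section \<open>Reduction of points of a realization\<close>

text \<open>One-step reductions from dimension \<open>n + 1\<close> to dimension \<open>n\<close>: a point with a vanishing coordinate
  lies in a face, and a point of a degenerate simplex comes from the simplex that it is a degeneracy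
  of. Both steps preserve the class of the point in the colimit.\<close>
definition reduces :: "'a simp_set \<Rightarrow> nat \<Rightarrow> 'a \<times> (nat \<Rightarrow> real) \<Rightarrow> 'a \<times> (nat \<Rightarrow> real) \<Rightarrow> bool" where
  "reduces X n s t \<longleftrightarrow> fst s \<in> simplices X (Suc n) \<and> snd s \<in> affine_simplex (Suc n) \<and>
     ((\<exists>i\<le>Suc n. snd s i = 0 \<and> t = (face X n i (fst s), delete_coord i (snd s))) \<or>
      (\<exists>j\<le>n. \<exists>y\<in>simplices X n. fst s = degen X n j y \<and> t = (y, merge_coords j (snd s))))"

lemma reduces_faceI:
  "x \<in> simplices X (Suc n) \<Longrightarrow> a \<in> affine_simplex (Suc n) \<Longrightarrow> a i = 0 \<Longrightarrow> i \<le> Suc n \<Longrightarrow>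
     reduces X n (x, a) (face X n i x, delete_coord i a)"
  by (auto simp: reduces_def)

lemma reduces_degenI:
  "simplicial_set X \<Longrightarrow> y \<in> simplices X n \<Longrightarrow> a \<in> affine_simplex (Suc n) \<Longrightarrow> j \<le> n \<Longrightarrow>
     reduces X n (degen X n j y, a) (y, merge_coords j a)"
  using degen_in by (auto simp: reduces_def)

lemma reduces_cases [consumes 1, case_names face degen]:
  assumes "reduces X n (x, a) t"
  obtains i where "x \<in> simplices X (Suc n)" "a \<in> affine_simplex (Suc n)" "i \<le> Suc n" "a i = 0"
      "t = (face X n i x, delete_coord i a)"
    | j y where "x \<in> simplices X (Suc n)" "a \<in> affine_simplex (Suc n)" "j \<le> n" "y \<in> simplices X n"
      "x = degen X n j y" "t = (y, merge_coords j a)"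
  using assms by (auto simp: reduces_def)

lemma reduces_target:
  assumes X: "simplicial_set X" and "reduces X n (x, a) (y, b)"
  shows "y \<in> simplices X n" "b \<in> affine_simplex n"
    "a \<in> standard_simplex (Suc n) \<Longrightarrow> b \<in> standard_simplex n"
  using assms(2)
  by (auto elim!: reduces_cases intro: face_in[OF X] delete_in_affine merge_in_affine
      delete_in_standard merge_in_standard)

lemma reduces_imp_class_eq:
  assumes X: "simplicial_set X" and r: "reduces X n (x, a) (y, b)"
  shows "realization_class X affine_simplex (Suc n, x) a = realization_class X affine_simplex (n, y) b"
    "a \<in> standard_simplex (Suc n) \<Longrightarrow>
      realization_class X standard_simplex (Suc n, x) a = realization_class X standard_simplex (n, y) b"
proof -
  have "realization_class X F (Suc n, x) a = realization_class X F (n, y) b"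
    if F: "a \<in> F (Suc n)" "b \<in> F n" for F
    using r
  proof (cases rule: reduces_cases)
    case (face i)
    then show ?thesis
      using realization_class_glue[OF coface_in_simplex_maps face(1), of b F i]
        push_coords_coface_delete[OF face(2,4,3)] F by (simp add: face_def)
  next
    case (degen j z)
    then show ?thesis
      using realization_class_glue[where F = F, OF codegen_in_simplex_maps[OF degen(3)] degen(4) F(1)]
        push_coords_codegen[OF degen(2,3)] by (simp add: degen_def)
  qed
  moreover have "a \<in> affine_simplex (Suc n)" using r by (simp add: reduces_def)
  ultimately show "realization_class X affine_simplex (Suc n, x) a = realization_class X affine_simplex (n, y) b"
    "a \<in> standard_simplex (Suc n) \<Longrightarrow>
      realization_class X standard_simplex (Suc n, x) a = realization_class X standard_simplex (n, y) b"
    using reduces_target[OF X r] by blast+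
qed

lemma diamond_face_face:
  assumes X: "simplicial_set X" and x: "x \<in> simplices X (Suc n)" and a: "a \<in> affine_simplex (Suc n)"
    and i: "i \<le> Suc n" "a i = 0" "t = (face X n i x, delete_coord i a)"
    and i': "i' \<le> Suc n" "i < i'" "a i' = 0" "t' = (face X n i' x, delete_coord i' a)"
  shows "\<exists>m u. n = Suc m \<and> reduces X m t u \<and> reduces X m t' u"
proof -
  \<comment> \<open>In dimension 1, two vanishing coordinates would make the sum 0.\<close>
  have "n \<noteq> 0"
  proof
    assume "n = 0"
    then have "i = 0" "i' = 1" using i i' by auto
    then have "a 0 = 0" "a (Suc 0) = 0" using i(2) i'(3) by auto
    then have "(\<Sum>k\<le>Suc n. a k) = 0" using \<open>n = 0\<close> by simp
    then show False using a by (simp add: affine_simplex_iff)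
  qed
  then obtain m where m: "n = Suc m" by (cases n) auto
  have "reduces X m t (face X m (i' - 1) (face X n i x), delete_coord (i' - 1) (delete_coord i a))"
    unfolding i using i i' m face_in[OF X x] delete_in_affine[OF a i(2,1)]
    by (intro reduces_faceI) (auto simp: delete_coord_def)
  moreover have "reduces X m t' (face X m i (face X n i' x), delete_coord i (delete_coord i' a))"
    unfolding i' using i i' m face_in[OF X x] delete_in_affine[OF a i'(3,1)]
    by (intro reduces_faceI) (auto simp: delete_coord_def)
  ultimately show ?thesis
    using m face_face[OF X i'(2), of x m] x m delete_delete[OF i'(2), of a] by auto
qed

lemma diamond_face_degen:
  assumes X: "simplicial_set X" and a: "a \<in> affine_simplex (Suc n)"
    and i: "i \<le> Suc n" "a i = 0" "t = (face X n i x, delete_coord i a)"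
    and j: "j \<le> n" "y \<in> simplices X n" "x = degen X n j y" "t' = (y, merge_coords j a)"
    and ne: "t \<noteq> t'"
  shows "\<exists>m u. n = Suc m \<and> reduces X m t u \<and> reduces X m t' u"
proof -
  have "\<not> (i = j \<or> i = Suc j)"
    using ne face_degen_same[OF X _ j(1,2), of i] delete_eq_merge[of a i j] i j by auto
  then have ij: "i < j \<or> Suc j < i" by auto
  then obtain m where m: "n = Suc m" using i j by (cases n) auto
  show ?thesis
    using ij
  proof
    assume ij: "i < j"
    have "reduces X m t (face X m i y, merge_coords (j - 1) (delete_coord i a))"
      using reduces_degenI[OF X face_in[OF X, of y m i], of "delete_coord i a" "j - 1"]
        face_degen_less[OF X ij, of m y] delete_in_affine[OF a i(2,1)] i j m ij by auto
    moreover have "reduces X m t' (face X m i y, delete_coord i (merge_coords j a))"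
      unfolding j using i j m ij merge_in_affine[OF a j(1)]
      by (intro reduces_faceI) (auto simp: merge_coords_def)
    ultimately show ?thesis using m delete_merge_less[OF ij, of a] by auto
  next
    assume ij: "Suc j < i"
    have "reduces X m t (face X m (i - 1) y, merge_coords j (delete_coord i a))"
      using reduces_degenI[OF X face_in[OF X, of y m "i - 1"], of "delete_coord i a" j]
        face_degen_greater[OF X ij, of m y] delete_in_affine[OF a i(2,1)] i j m ij by auto
    moreover have "reduces X m t' (face X m (i - 1) y, delete_coord (i - 1) (merge_coords j a))"
      unfolding j using i j m ij merge_in_affine[OF a j(1)]
      by (intro reduces_faceI) (auto simp: merge_coords_def)
    ultimately show ?thesis using m delete_merge_greater[OF ij, of a] by auto
  qed
qed

lemma diamond_degen_degen:
  assumes X: "simplicial_set X" and a: "a \<in> affine_simplex (Suc n)"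
    and j: "j \<le> n" "y \<in> simplices X n" "x = degen X n j y" "t = (y, merge_coords j a)"
    and j': "j' \<le> n" "j < j'" "y' \<in> simplices X n" "x = degen X n j' y'" "t' = (y', merge_coords j' a)"
  shows "\<exists>m u. n = Suc m \<and> reduces X m t u \<and> reduces X m t' u"
proof -
  obtain m where m: "n = Suc m" using j j' by (cases n) auto
  obtain w where w: "w \<in> simplices X m" "y = degen X m (j' - 1) w" "y' = degen X m j w"
    using degen_eq_degen[OF X, of m j y j' y'] j j' m by auto
  have "reduces X m t (w, merge_coords (j' - 1) (merge_coords j a))"
    using reduces_degenI[OF X w(1), of "merge_coords j a" "j' - 1"] merge_in_affine[OF a j(1)] w j j' m by auto
  moreover have "reduces X m t' (w, merge_coords j (merge_coords j' a))"
    using reduces_degenI[OF X w(1), of "merge_coords j' a" j] merge_in_affine[OF a j'(1)] w j j' m by auto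
  ultimately show ?thesis using m merge_merge[OF j'(2), of a] by auto
qed

text \<open>Local confluence with a common reduct after exactly one further step. In dimension 1 two reductions
  of a point always agree, which is why the dimension is at least 2 in the conclusion.\<close>
lemma reduces_diamond:
  assumes X: "simplicial_set X" and s: "reduces X n s t" and s': "reduces X n s t'" and ne: "t \<noteq> t'"
  shows "\<exists>m u. n = Suc m \<and> reduces X m t u \<and> reduces X m t' u"
proof -
  obtain x a where sx: "s = (x, a)" by (cases s)
  from s[unfolded sx] show ?thesis
  proof (cases rule: reduces_cases)
    case i: (face i)
    from s'[unfolded sx] show ?thesis
    proof (cases rule: reduces_cases)
      case i': (face i')
      consider "i < i'" | "i' < i" using ne i(5) i'(5) by (cases i i' rule: linorder_cases) auto
      then show ?thesis
      proof cases
        case 1 show ?thesis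
          by (rule diamond_face_face[OF X i(1-5) i'(3) 1 i'(4,5)])
      next
        case 2 show ?thesis
          using diamond_face_face[OF X i'(1-5) i(3) 2 i(4,5)] by blast
      qed
    next
      case j': (degen j' y')
      show ?thesis
        by (rule diamond_face_degen[OF X i(2-5) j'(3-6) ne])
    qed
  next
    case j: (degen j y)
    from s'[unfolded sx] show ?thesis
    proof (cases rule: reduces_cases)
      case i': (face i')
      show ?thesis
        using diamond_face_degen[OF X i'(2-5) j(3-6) ne[symmetric]] by blast
    next
      case j': (degen j' y')
      have "j \<noteq> j'"
      proof
        assume "j = j'"
        then have "y = y'"
          using face_degen_same[OF X, of j j n y] face_degen_same[OF X, of j j n y'] j(3-5) j'(4,5)
          by simp
        then show False using ne j(6) j'(6) \<open>j = j'\<close> by simp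
      qed
      then consider "j < j'" | "j' < j" by linarith
      then show ?thesis
      proof cases
        case 1 show ?thesis
          by (rule diamond_degen_degen[OF X j(2-6) j'(3) 1 j'(4-6)])
      next
        case 2 show ?thesis
          using diamond_degen_degen[OF X j'(2-6) j(3) 2 j(4-6)] by blast
      qed
    qed
  qed
qed

text \<open>The reductions generate the relation that defines the colimit.\<close>
lemma reduces_invariant_imp_natural:
  assumes X: "simplicial_set X"
    and inv: "\<And>n x a y b. reduces X n (x, a) (y, b) \<Longrightarrow> h (Suc n) x a = h n y b"
    and "f \<in> simplex_maps m n" "y \<in> simplices X n" "a \<in> affine_simplex m"
  shows "h m (act X m n f y) a = h n y (push_coords m f a)"
  using assms(3-)
proof (induction "m + n" arbitrary: m n f y a rule: less_induct)
  case less
  from \<open>f \<in> simplex_maps m n\<close> show ?case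
  proof (cases rule: simplex_maps_cases)
    case id
    then show ?thesis using less.prems by (simp add: act_id[OF X] push_coords_id)
  next
    case (coface i n' g)
    have y: "y \<in> simplices X (Suc n')" using less.prems coface by simp
    have b: "push_coords m g a \<in> affine_simplex n'" by (rule push_coords_in_affine) fact+
    have "h m (act X m n f y) a = h m (act X m n' g (face X n' i y)) a"
      using coface y by (simp add: face_def act_act[OF X _ coface_in_simplex_maps])
    also have "\<dots> = h n' (face X n' i y) (push_coords m g a)"
      using less.hyps[of m n' g "face X n' i y" a] coface less.prems face_in[OF X y] by simp
    also have "\<dots> = h (Suc n') y (push_coords n' (coface n' i) (push_coords m g a))"
      using inv[OF reduces_faceI[where i = i, OF y push_coords_in_affine[OF coface_in_simplex_maps b]]]
        delete_push_coords_coface[OF b, of i] coface by simp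
    also have "\<dots> = h n y (push_coords m f a)"
      using coface push_coords_compose[of g m n' "coface n' i" a] by simp
    finally show ?thesis .
  next
    case (codegen j m' g)
    have z: "act X m' n g y \<in> simplices X m'" using act_in[OF X] codegen less.prems by blast
    have a: "a \<in> affine_simplex (Suc m')" using less.prems codegen by simp
    have "h m (act X m n f y) a = h (Suc m') (degen X m' j (act X m' n g y)) a"
      using codegen less.prems by (simp add: degen_def act_act[OF X codegen_in_simplex_maps])
    also have "\<dots> = h m' (act X m' n g y) (merge_coords j a)"
      by (rule inv[OF reduces_degenI[OF X z a]]) fact
    also have "\<dots> = h n y (push_coords m' g (merge_coords j a))"
      using less.hyps[of m' n g y "merge_coords j a"] codegen less.prems merge_in_affine[OF a] by simp
    also have "\<dots> = h n y (push_coords m f a)"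
      using codegen push_coords_compose[of "codegen m' j" m m' g a] push_coords_codegen[OF a]
        codegen_in_simplex_maps by simp
    finally show ?thesis .
  qed
qed


section \<open>Pushing an affine simplex onto its standard simplex and its boundary\<close>

text \<open>Let \<open>S\<close> be the set of negative coordinates. Moving the coordinates in \<open>S\<close> up at speed
  \<open>1/|S|\<close> and the others down at speed \<open>1/|{0..n} - S|\<close>, which preserves the sum, the
  coordinate \<open>i\<close> vanishes after \<open>|a\<^sub>i|\<close> times the size of its sign class. The minimum of
  these times is when the boundary is reached. For empty \<open>S\<close> the point is in the standard simplex and
  must not move.\<close>
definition exit_time :: "nat \<Rightarrow> nat set \<Rightarrow> (nat \<Rightarrow> real) \<Rightarrow> real" where
  "exit_time n S a = (if S = {} then 0
     else Min ((\<lambda>i. \<bar>a i\<bar> * real (card (if i \<in> S then S else {..n} - S))) ` {..n}))"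

text \<open>The position at the exit time. The set \<open>S\<close> is a parameter because for fixed \<open>S\<close> the formula
  is continuous in \<open>a\<close>.\<close>
definition shift_across :: "nat \<Rightarrow> nat set \<Rightarrow> (nat \<Rightarrow> real) \<Rightarrow> nat \<Rightarrow> real" where
  "shift_across n S a = (\<lambda>i. if i \<in> S then a i + exit_time n S a / real (card S)
     else if i \<le> n then a i - exit_time n S a / real (card ({..n} - S)) else a i)"

text \<open>The retraction of the affine simplex onto the union of the standard simplex and the hyperplanes
  \<open>a\<^sub>i = 0\<close>.\<close>
definition boundary_push :: "nat \<Rightarrow> (nat \<Rightarrow> real) \<Rightarrow> nat \<Rightarrow> real" where
  "boundary_push n a = shift_across n {i. i \<le> n \<and> a i < 0} a"

lemma exit_time_boundary:
  assumes "i \<le> n" "a i = 0"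
  shows "exit_time n S a = 0"
proof -
  let ?M = "(\<lambda>i. \<bar>a i\<bar> * real (card (if i \<in> S then S else {..n} - S))) ` {..n}"
  have "0 \<in> ?M" using assms by force
  then have "Min ?M = 0" by (intro Min_eqI) auto
  then show ?thesis by (simp add: exit_time_def)
qed

lemma shift_across_id: "exit_time n S a = 0 \<Longrightarrow> shift_across n S a = a"
  by (auto simp: shift_across_def fun_eq_iff)

lemma boundary_push_boundary: "i \<le> n \<Longrightarrow> a i = 0 \<Longrightarrow> boundary_push n a = a"
  by (simp add: boundary_push_def shift_across_id exit_time_boundary)

lemma boundary_push_standard:
  assumes "a \<in> standard_simplex n" shows "boundary_push n a = a"
proof -
  have "{i. i \<le> n \<and> a i < 0} = {}" using assms by (auto simp: standard_simplex_iff not_less)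
  then show ?thesis by (simp add: boundary_push_def shift_across_id exit_time_def)
qed

lemma exists_positive_coord:
  assumes "a \<in> affine_simplex n" shows "\<exists>i\<le>n. 0 < a i"
proof (rule ccontr)
  assume "\<not> ?thesis"
  then have "(\<Sum>i\<le>n. a i) \<le> 0" by (intro sum_nonpos) auto
  then show False using assms by (simp add: affine_simplex_iff)
qed

lemma boundary_push_in_affine:
  assumes a: "a \<in> affine_simplex n" shows "boundary_push n a \<in> affine_simplex n"
proof -
  define S where "S = {i. i \<le> n \<and> a i < 0}"
  define s where "s = exit_time n S a"
  show ?thesis
  proof (cases "S = {}")
    case True
    then show ?thesis using a by (simp add: boundary_push_def shift_across_id exit_time_def S_def)
  next
    case False
    have S: "S \<subseteq> {..n}" "finite S" by (auto simp: S_def)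
    \<comment> \<open>Neither sign class is empty, so the two speeds are defined and cancel in the sum.\<close>
    obtain p where "p \<le> n" "0 < a p" using exists_positive_coord[OF a] by auto
    then have "p \<in> {..n} - S" by (simp add: S_def)
    then have T: "{..n} - S \<noteq> {}" by blast
    have "(\<Sum>i\<le>n. boundary_push n a i) = (\<Sum>i\<in>S. boundary_push n a i) + (\<Sum>i\<in>{..n} - S. boundary_push n a i)"
      using sum.subset_diff[OF S(1), of "boundary_push n a"] by simp
    also have "(\<Sum>i\<in>S. boundary_push n a i) = (\<Sum>i\<in>S. a i + s / real (card S))"
      by (intro sum.cong) (auto simp: boundary_push_def shift_across_def S_def s_def)
    also have "\<dots> = (\<Sum>i\<in>S. a i) + s"
      using False S by (simp add: sum.distrib)
    also have "(\<Sum>i\<in>{..n} - S. boundary_push n a i) = (\<Sum>i\<in>{..n} - S. a i - s / real (card ({..n} - S)))"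
      by (intro sum.cong) (auto simp: boundary_push_def shift_across_def S_def s_def)
    also have "\<dots> = (\<Sum>i\<in>{..n} - S. a i) - s"
      using T by (simp add: sum_subtractf)
    also have "(\<Sum>i\<in>S. a i) + s + ((\<Sum>i\<in>{..n} - S. a i) - s) = (\<Sum>i\<le>n. a i)"
      using sum.subset_diff[OF S(1), of a] by simp
    finally show ?thesis using a by (auto simp: affine_simplex_iff boundary_push_def shift_across_def)
  qed
qed

lemma boundary_push_hits_boundary:
  assumes a: "a \<in> affine_simplex n" "a \<notin> standard_simplex n"
  shows "\<exists>i\<le>n. boundary_push n a i = 0"
proof -
  define S where "S = {i. i \<le> n \<and> a i < 0}"
  have S: "finite S" "S \<noteq> {}"
    using a by (auto simp: S_def standard_simplex_iff affine_simplex_iff not_le)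
  have "exit_time n S a \<in> (\<lambda>i. \<bar>a i\<bar> * real (card (if i \<in> S then S else {..n} - S))) ` {..n}"
    unfolding exit_time_def if_not_P[OF S(2)] by (rule Min_in) auto
  then obtain i where i: "i \<le> n"
    "exit_time n S a = \<bar>a i\<bar> * real (card (if i \<in> S then S else {..n} - S))" by auto
  have "boundary_push n a i = 0"
  proof (cases "i \<in> S")
    case True
    then have "card S \<noteq> 0" using S by auto
    then show ?thesis using i True by (auto simp: boundary_push_def shift_across_def S_def)
  next
    case False
    then have "card ({..n} - S) \<noteq> 0" using i by auto
    then show ?thesis using i False by (auto simp: boundary_push_def shift_across_def S_def not_less)
  qed
  then show ?thesis using i by blast
qed

lemma continuous_on_shift_across:
  "continuous_on A (shift_across n S)"
proof -
  have e: "continuous_on A (exit_time n S)"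
  proof (cases "S = {}")
    case False
    have "continuous_on A (\<lambda>a. Min ((\<lambda>i. \<bar>a i\<bar> * real (card (if i \<in> S then S else {..n} - S))) ` {..n}))"
      by (intro continuous_on_Min_image continuous_on_mult continuous_on_rabs continuous_on_coord
          continuous_on_const) auto
    then show ?thesis using False by (simp add: exit_time_def[abs_def])
  qed (simp add: exit_time_def[abs_def])
  have "continuous_on A (\<lambda>a. shift_across n S a i)" for i
    unfolding shift_across_def divide_inverse
    by (cases "i \<in> S"; cases "i \<le> n")
      (simp_all, (intro continuous_on_add continuous_on_diff continuous_on_mult e
        continuous_on_coord continuous_on_const)+)
  then show ?thesis by (intro continuous_on_coordinatewise_then_product)
qed

text \<open>On the closed region of a sign pattern \<open>S\<close>, in which coordinates may vanish, the push is the
  formula for \<open>S\<close>: where it is not the formula for the actual set of negative coordinates, some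
  coordinate vanishes and both formulas are the identity.\<close>
lemma continuous_on_boundary_push: "continuous_on (affine_simplex n) (boundary_push n)"
proof -
  let ?A = "affine_simplex n"
  define C where "C S = {a :: nat \<Rightarrow> real. \<forall>i\<le>n. (i \<in> S \<longrightarrow> a i \<le> 0) \<and> (i \<notin> S \<longrightarrow> 0 \<le> a i)}"
    for S
  have C: "closed (C S)" for S
  proof -
    have "C S = (\<Inter>i\<in>{..n}. if i \<in> S then {a. a i \<le> 0} else {a. 0 \<le> a i})"
      by (auto simp: C_def split: if_splits)
    moreover have "closed {a :: nat \<Rightarrow> real. a i \<le> 0}" "closed {a :: nat \<Rightarrow> real. 0 \<le> a i}" for i
      by (intro closed_Collect_le continuous_on_coord continuous_on_const)+
    ultimately show ?thesis by (auto intro!: closed_INT)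
  qed
  have eq: "boundary_push n a = shift_across n S a" if "a \<in> C S" "S \<subseteq> {..n}" for a S
  proof (cases "\<exists>i\<le>n. a i = 0")
    case True
    then show ?thesis using boundary_push_boundary shift_across_id exit_time_boundary by metis
  next
    case False
    then have "{i. i \<le> n \<and> a i < 0} = S" using that
      by (auto simp: C_def) (metis atMost_iff less_eq_real_def subsetD)+
    then show ?thesis by (simp add: boundary_push_def)
  qed
  have "continuous_map (top_of_set ?A) euclidean (boundary_push n)"
  proof (rule pasting_lemma_closed[where I = "Pow {..n}" and T = "\<lambda>S. ?A \<inter> C S" and f = "shift_across n"])
    show "closedin (top_of_set ?A) (?A \<inter> C S)" for S
      using C by (simp add: closedin_closed_Int)
    show "continuous_map (subtopology (top_of_set ?A) (?A \<inter> C S)) euclidean (shift_across n S)" for S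
      by (simp add: subtopology_subtopology continuous_on_shift_across)
    show "shift_across n S a = shift_across n S' a" if "S \<in> Pow {..n}" "S' \<in> Pow {..n}"
      "a \<in> topspace (top_of_set ?A) \<inter> (?A \<inter> C S) \<inter> (?A \<inter> C S')" for S S' a
      using eq[of a S] eq[of a S'] that by auto
    show "\<exists>S. S \<in> Pow {..n} \<and> a \<in> ?A \<inter> C S \<and> boundary_push n a = shift_across n S a"
      if "a \<in> topspace (top_of_set ?A)" for a
      using that by (intro exI[of _ "{i. i \<le> n \<and> a i < 0}"]) (auto simp: C_def boundary_push_def)
  qed auto
  then show ?thesis by simp
qed


section \<open>Functions on the colimit defined by reductions and pushes\<close>

text \<open>Recursion along the dimension. A reducible point is reduced; at an irreducible point the
  recursion stops with the value \<open>v\<close> if the point lies in the standard simplex or the time \<open>\<tau>\<close> is at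
  most \<open>c n\<close>; otherwise the point is pushed to the boundary and reduced there. The bound for
  dimension \<open>n + 1\<close> is \<open>c n\<close>, as no bound is needed in dimension 0. The choices of
  reductions are arbitrary; the next lemma shows that the value does not depend on them.\<close>
primrec collapse_value ::
    "'a simp_set \<Rightarrow> (nat \<Rightarrow> real) \<Rightarrow> (nat \<Rightarrow> 'a \<Rightarrow> real \<Rightarrow> (nat \<Rightarrow> real) \<Rightarrow> 'z) \<Rightarrow>
     nat \<Rightarrow> 'a \<Rightarrow> real \<Rightarrow> (nat \<Rightarrow> real) \<Rightarrow> 'z" where
  "collapse_value X c v 0 x \<tau> a = v 0 x \<tau> a"
| "collapse_value X c v (Suc n) x \<tau> a =
    (if \<exists>t. reduces X n (x, a) t then
       (let t = (SOME t. reduces X n (x, a) t) in collapse_value X c v n (fst t) \<tau> (snd t))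
     else if a \<in> standard_simplex (Suc n) \<or> \<tau> \<le> c n then v (Suc n) x \<tau> a
     else (let t = (SOME t. reduces X n (x, boundary_push (Suc n) a) t) in collapse_value X c v n (fst t) \<tau> (snd t)))"

declare collapse_value.simps(2) [simp del]

lemma collapse_value_reduces:
  assumes X: "simplicial_set X" and "reduces X n (x, a) (y, b)"
  shows "collapse_value X c v (Suc n) x \<tau> a = collapse_value X c v n y \<tau> b"
  using assms(2)
proof (induction n arbitrary: x a y b rule: less_induct)
  case (less n)
  define t where "t = (SOME t. reduces X n (x, a) t)"
  have t: "reduces X n (x, a) t" unfolding t_def using less.prems by (rule someI)
  have R: "collapse_value X c v (Suc n) x \<tau> a = collapse_value X c v n (fst t) \<tau> (snd t)"
    using less.prems by (auto simp: t_def Let_def collapse_value.simps(2))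
  show ?case
  proof (cases "t = (y, b)")
    case False
    then obtain m u where m: "n = Suc m" "reduces X m t u" "reduces X m (y, b) u"
      using reduces_diamond[OF X t less.prems] by blast
    have "collapse_value X c v n (fst t) \<tau> (snd t) = collapse_value X c v m (fst u) \<tau> (snd u)"
      using less.IH[of m "fst t" "snd t" "fst u" "snd u"] m by simp
    also have "\<dots> = collapse_value X c v n y \<tau> b"
      using less.IH[of m y b "fst u" "snd u"] m by simp
    finally show ?thesis using R by simp
  qed (use R in simp)
qed

lemma collapse_value_natural:
  assumes X: "simplicial_set X" and "f \<in> simplex_maps m n" "y \<in> simplices X n" "a \<in> affine_simplex m"
  shows "collapse_value X c v m (act X m n f y) \<tau> a = collapse_value X c v n y \<tau> (push_coords m f a)"
  by (rule reduces_invariant_imp_natural[where h = "\<lambda>n x a. collapse_value X c v n x \<tau> a", OF X _ assms(2-)])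
    (rule collapse_value_reduces[OF X])

text \<open>The topological analogue of the geometric realization with affine instead of standard simplices.\<close>
definition affine_realization :: "'a simp_set \<Rightarrow> (nat \<times> 'a \<times> (nat \<Rightarrow> real)) set topology" where
  "affine_realization X =
     final_topology (realization_points X affine_simplex) (all_simplices X)
       (\<lambda>(n, x). subtopology (powertop_real UNIV) (affine_simplex n))
       (realization_class X affine_simplex)"

text \<open>Conditions on \<open>v\<close> and \<open>c\<close> that make the recursion continuous. On standard simplices, \<open>v\<close> is
  continuous and compatible with reductions. Before the time at which the recursion goes below
  dimension \<open>n + 1\<close>, \<open>v\<close> is continuous on the whole affine simplex, and compatible with reductions of
  boundary points; before the earlier time belonging to dimension \<open>n + 2\<close> it is compatible with all
  reductions. At the time \<open>c n\<close> itself, pushing a point does not change \<open>v\<close>.\<close>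
locale collapse =
  fixes X :: "'a simp_set" and c :: "nat \<Rightarrow> real"
    and v :: "nat \<Rightarrow> 'a \<Rightarrow> real \<Rightarrow> (nat \<Rightarrow> real) \<Rightarrow> 'z" and Z :: "'z topology"
  assumes X: "simplicial_set X"
    and c_decreasing: "c (Suc n) \<le> c n"
    and cont_standard: "x \<in> simplices X n \<Longrightarrow>
        continuous_map (top_of_set ({0..1} \<times> standard_simplex n)) Z (\<lambda>(\<tau>, a). v n x \<tau> a)"
    and reduces_standard: "reduces X n (x, a) (y, b) \<Longrightarrow> a \<in> standard_simplex (Suc n) \<Longrightarrow>
        v (Suc n) x \<tau> a = v n y \<tau> b"
    and cont_early: "x \<in> simplices X (Suc n) \<Longrightarrow>
        continuous_map (top_of_set (({0..1} \<inter> {..c n}) \<times> affine_simplex (Suc n))) Z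
          (\<lambda>(\<tau>, a). v (Suc n) x \<tau> a)"
    and reduces_early: "reduces X n (x, a) (y, b) \<Longrightarrow> 0 \<le> \<tau> \<Longrightarrow>
        \<tau> \<le> c (Suc n) \<or> \<tau> \<le> c n \<and> (\<exists>i\<le>Suc n. a i = 0) \<Longrightarrow> v (Suc n) x \<tau> a = v n y \<tau> b"
    and boundary_push_early: "x \<in> simplices X (Suc n) \<Longrightarrow> a \<in> affine_simplex (Suc n) \<Longrightarrow> 0 \<le> c n \<Longrightarrow>
        v (Suc n) x (c n) (boundary_push (Suc n) a) = v (Suc n) x (c n) a"
begin

abbreviation R :: "nat \<Rightarrow> 'a \<Rightarrow> real \<Rightarrow> (nat \<Rightarrow> real) \<Rightarrow> 'z" where
  "R \<equiv> collapse_value X c v"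

lemma R_standard:
  "x \<in> simplices X n \<Longrightarrow> a \<in> standard_simplex n \<Longrightarrow> R n x \<tau> a = v n x \<tau> a"
proof (induction n arbitrary: x a)
  case (Suc n)
  show ?case
  proof (cases "\<exists>y b. reduces X n (x, a) (y, b)")
    case True
    then obtain y b where yb: "reduces X n (x, a) (y, b)" by blast
    have "R (Suc n) x \<tau> a = R n y \<tau> b" by (rule collapse_value_reduces[OF X yb])
    also have "\<dots> = v n y \<tau> b"
      using Suc.IH[OF reduces_target(1)[OF X yb] reduces_target(3)[OF X yb Suc.prems(2)]] .
    also have "\<dots> = v (Suc n) x \<tau> a" using reduces_standard[OF yb Suc.prems(2)] by simp
    finally show ?thesis .
  next
    case False
    then show ?thesis using Suc.prems by (simp add: collapse_value.simps(2))
  qed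
qed simp

text \<open>Before the time belonging to the next higher dimension all reductions preserve \<open>v\<close>, whether or not
  the simplex is degenerate.\<close>
lemma R_early:
  "x \<in> simplices X n \<Longrightarrow> a \<in> affine_simplex n \<Longrightarrow> 0 \<le> \<tau> \<Longrightarrow> \<tau> \<le> c n \<Longrightarrow> R n x \<tau> a = v n x \<tau> a"
proof (induction n arbitrary: x a)
  case (Suc n)
  have \<tau>: "\<tau> \<le> c n" using Suc.prems c_decreasing[of n] by simp
  show ?case
  proof (cases "\<exists>y b. reduces X n (x, a) (y, b)")
    case True
    then obtain y b where yb: "reduces X n (x, a) (y, b)" by blast
    have "R (Suc n) x \<tau> a = R n y \<tau> b" by (rule collapse_value_reduces[OF X yb])
    also have "\<dots> = v n y \<tau> b"
      using Suc.IH[OF reduces_target(1,2)[OF X yb] Suc.prems(3) \<tau>] .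
    also have "\<dots> = v (Suc n) x \<tau> a" using reduces_early[OF yb Suc.prems(3)] Suc.prems(4) by simp
    finally show ?thesis .
  next
    case False
    then show ?thesis using \<tau> by (simp add: collapse_value.simps(2))
  qed
qed simp

text \<open>On the boundary the value is \<open>v\<close> up to the time \<open>c n\<close> of the dimension itself, as one reduction leads
  to the range of the previous lemma.\<close>
lemma R_boundary:
  assumes x: "x \<in> simplices X (Suc n)" and a: "a \<in> affine_simplex (Suc n)"
    and i: "i \<le> Suc n" "a i = 0" and \<tau>: "0 \<le> \<tau>" "\<tau> \<le> c n"
  shows "R (Suc n) x \<tau> a = v (Suc n) x \<tau> a"
proof -
  have r: "reduces X n (x, a) (face X n i x, delete_coord i a)" by (rule reduces_faceI[OF x a i(2,1)])
  have "R (Suc n) x \<tau> a = R n (face X n i x) \<tau> (delete_coord i a)" by (rule collapse_value_reduces[OF X r])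
  also have "\<dots> = v n (face X n i x) \<tau> (delete_coord i a)"
    by (rule R_early[OF reduces_target(1,2)[OF X r] \<tau>])
  also have "\<dots> = v (Suc n) x \<tau> a"
    by (rule reduces_early[OF r, symmetric]) (use i \<tau> in auto)
  finally show ?thesis .
qed

text \<open>Nondegeneracy of an \<open>(n + 1)\<close>-simplex. Points of such a simplex with all coordinates nonzero are
  irreducible.\<close>
definition nondegenerate :: "nat \<Rightarrow> 'a \<Rightarrow> bool" where
  "nondegenerate n x \<longleftrightarrow> (\<forall>j\<le>n. \<forall>y\<in>simplices X n. x \<noteq> degen X n j y)"

lemma irreducible:
  "nondegenerate n x \<Longrightarrow> \<forall>i\<le>Suc n. a i \<noteq> 0 \<Longrightarrow> \<not> reduces X n (x, a) t"
  by (auto simp: nondegenerate_def elim!: reduces_cases)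

lemma R_stop:
  assumes x: "x \<in> simplices X (Suc n)" "nondegenerate n x" and a: "a \<in> affine_simplex (Suc n)"
    and \<tau>: "0 \<le> \<tau>" "\<tau> \<le> c n"
  shows "R (Suc n) x \<tau> a = v (Suc n) x \<tau> a"
proof (cases "\<exists>i\<le>Suc n. a i = 0")
  case False
  then have "\<nexists>t. reduces X n (x, a) t" using irreducible[OF x(2)] by blast
  then show ?thesis using \<tau> by (simp add: collapse_value.simps(2))
qed (use R_boundary[OF x(1) a _ _ \<tau>] in blast)

text \<open>At late times the value on a nondegenerate simplex factors through the push. Each choice of a
  reduction of the pushed point gives the same value, so the recursion may be read as continuing
  from the pushed point itself.\<close>
lemma R_boundary_push:
  assumes x: "x \<in> simplices X (Suc n)" "nondegenerate n x" and a: "a \<in> affine_simplex (Suc n)"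
    and \<tau>: "0 \<le> \<tau>" "c n \<le> \<tau>"
  shows "R (Suc n) x \<tau> (boundary_push (Suc n) a) = R (Suc n) x \<tau> a"
proof (cases "(\<exists>i\<le>Suc n. a i = 0) \<or> a \<in> standard_simplex (Suc n)")
  case True
  then show ?thesis using boundary_push_boundary[of _ "Suc n" a] boundary_push_standard[of a "Suc n"] by force
next
  case False
  obtain i where i: "i \<le> Suc n" "boundary_push (Suc n) a i = 0" using boundary_push_hits_boundary[OF a] False by blast
  show ?thesis
  proof (cases "\<tau> \<le> c n")
    case True
    then show ?thesis
      using R_stop[OF x a \<tau>(1)] R_stop[OF x boundary_push_in_affine[OF a] \<tau>(1)] boundary_push_early[OF x(1) a] \<tau> by simp
  next
    case late: False
    define t where "t = (SOME t. reduces X n (x, boundary_push (Suc n) a) t)"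
    have "reduces X n (x, boundary_push (Suc n) a) (face X n i x, delete_coord i (boundary_push (Suc n) a))"
      by (rule reduces_faceI[OF x(1) boundary_push_in_affine[OF a] i(2,1)])
    then have "reduces X n (x, boundary_push (Suc n) a) t" unfolding t_def by (rule someI)
    then have "R (Suc n) x \<tau> (boundary_push (Suc n) a) = R n (fst t) \<tau> (snd t)"
      using collapse_value_reduces[OF X, of n x "boundary_push (Suc n) a" "fst t" "snd t"] by simp
    also have "\<dots> = R (Suc n) x \<tau> a"
      using irreducible[OF x(2), of a] False late by (simp add: t_def Let_def collapse_value.simps(2))
    finally show ?thesis .
  qed
qed

text \<open>Induction on the dimension. A degenerate simplex reduces to a lower one by a continuous map. For a
  nondegenerate simplex, continuity on the standard simplex and on the faces gives continuity on
  their union; the push extends this to the affine simplex at late times, and at early times the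
  value is \<open>v\<close>.\<close>
lemma continuous_map_R:
  "x \<in> simplices X n \<Longrightarrow>
     continuous_map (top_of_set ({0..1} \<times> affine_simplex n)) Z (\<lambda>(\<tau>, a). R n x \<tau> a)"
proof (induction n arbitrary: x)
  case 0
  then show ?case using cont_standard[OF 0] by (simp add: affine_simplex_0)
next
  case (Suc n)
  let ?A = "affine_simplex (Suc n)" and ?S = "standard_simplex (Suc n)"
  show ?case
  proof (cases "nondegenerate n x")
    case False
    then obtain j y where y: "j \<le> n" "y \<in> simplices X n" "x = degen X n j y"
      by (auto simp: nondegenerate_def)
    have "continuous_map (top_of_set ({0..1} \<times> ?A)) Z (\<lambda>(\<tau>, a). R n y \<tau> (merge_coords j a))"
      using merge_in_affine y(1)
      by (intro continuous_map_second_factor[OF continuous_on_merge_coords _ Suc.IH[OF y(2)]]) auto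
    then show ?thesis
      by (rule continuous_map_eq)
        (use collapse_value_reduces[OF X reduces_degenI[OF X y(2) _ y(1)], where c = c and v = v] y(3) in auto)
  next
    case nd: True
    \<comment> \<open>On \<open>B\<close>, to which the push retracts \<open>?A\<close>, the value is \<open>v\<close> or that of a face.\<close>
    define F where "F i = {a \<in> ?A. a i = 0}" for i
    have F: "closed (F i)" for i
    proof -
      have "F i = ?A \<inter> {a. a i = 0}" by (auto simp: F_def)
      then show ?thesis
        using closed_affine_simplex
        by (auto intro!: closed_Int closed_Collect_eq continuous_on_coord continuous_on_const)
    qed
    define B where "B = ?S \<union> (\<Union>i\<le>Suc n. F i)"
    define T where "T = case_option ?S F"
    define k where "k = case_option (\<lambda>(\<tau>, a). v (Suc n) x \<tau> a)
      (\<lambda>i (\<tau>, a). R n (face X n i x) \<tau> (delete_coord i a))"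
    have cB: "continuous_map (top_of_set ({0..1} \<times> B)) Z (\<lambda>(\<tau>, a). R (Suc n) x \<tau> a)"
    proof (rule pasting_lemma_closed[where I = "insert None (Some ` {..Suc n})"
          and T = "\<lambda>i. {0..1} \<times> T i" and f = k])
      fix i assume i: "i \<in> insert None (Some ` {..Suc n})"
      have sub: "T i \<subseteq> B" using i by (auto simp: T_def B_def)
      have "closed (T i)" using F closed_standard_simplex by (auto simp: T_def split: option.split)
      then show "closedin (top_of_set ({0..1::real} \<times> B)) ({0..1} \<times> T i)"
        using sub by (intro closed_subset closed_Times closed_atLeastAtMost) auto
      have "continuous_map (top_of_set ({0..1} \<times> T i)) Z (k i)"
      proof (cases i)
        case None
        then show ?thesis using cont_standard[OF Suc.prems] by (simp add: k_def T_def)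
      next
        case (Some l)
        then have l: "l \<le> Suc n" using i by auto
        have "continuous_map (top_of_set ({0..1} \<times> F l)) Z
            (\<lambda>(\<tau>, a). R n (face X n l x) \<tau> (delete_coord l a))"
          using delete_in_affine l
          by (intro continuous_map_second_factor[OF continuous_on_delete_coord _ Suc.IH[OF face_in[OF X Suc.prems]]])
            (auto simp: F_def)
        then show ?thesis by (simp add: Some k_def T_def)
      qed
      then show "continuous_map (subtopology (top_of_set ({0..1} \<times> B)) ({0..1} \<times> T i)) Z (k i)"
        using sub by (simp add: subtopology_subtopology inf.absorb2 Sigma_mono)
    next
      have k: "k i (\<tau>, a) = R (Suc n) x \<tau> a"
        if "i \<in> insert None (Some ` {..Suc n})" "a \<in> T i" for i \<tau> a
        using that R_standard[OF Suc.prems, of a \<tau>]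
          collapse_value_reduces[OF X reduces_faceI[OF Suc.prems], of a _ c v \<tau>]
        by (auto simp: k_def T_def F_def)
      show "k i p = k j p" if "i \<in> insert None (Some ` {..Suc n})" "j \<in> insert None (Some ` {..Suc n})"
        "p \<in> topspace (top_of_set ({0..1} \<times> B)) \<inter> {0..1} \<times> T i \<inter> {0..1} \<times> T j" for i j p
        using that k[of i "snd p" "fst p"] k[of j "snd p" "fst p"] by auto
      show "\<exists>i. i \<in> insert None (Some ` {..Suc n}) \<and> p \<in> {0..1} \<times> T i \<and>
          (case p of (\<tau>, a) \<Rightarrow> R (Suc n) x \<tau> a) = k i p"
        if p: "p \<in> topspace (top_of_set ({0..1} \<times> B))" for p
      proof -
        obtain \<tau> a where pa: "p = (\<tau>, a)" "\<tau> \<in> {0..1}" "a \<in> B" using p by auto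
        then have "a \<in> T None \<or> (\<exists>l\<le>Suc n. a \<in> T (Some l))" by (auto simp: B_def T_def)
        then obtain i where "i \<in> insert None (Some ` {..Suc n})" "a \<in> T i" by blast
        then show ?thesis using k pa by (intro exI[of _ i]) auto
      qed
    qed auto
    \<comment> \<open>Up to time \<open>c n\<close> the value is \<open>v\<close>; from then on it factors through the push to \<open>B\<close>.\<close>
    have push_B: "boundary_push (Suc n) ` ?A \<subseteq> B"
      using boundary_push_hits_boundary boundary_push_in_affine boundary_push_standard by (fastforce simp: B_def F_def)
    show ?thesis
    proof (rule pasting_lemma_closed[where I = "UNIV :: bool set"
          and T = "\<lambda>b. ({0..1} \<inter> (if b then {..c n} else {c n..})) \<times> ?A"
          and f = "\<lambda>b. if b then (\<lambda>(\<tau>, a). v (Suc n) x \<tau> a)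
                         else (\<lambda>(\<tau>, a). R (Suc n) x \<tau> (boundary_push (Suc n) a))"])
      show "closedin (top_of_set ({0..1} \<times> ?A)) (({0..1} \<inter> (if b then {..c n} else {c n..})) \<times> ?A)" for b
        using closed_affine_simplex by (intro closed_subset closed_Times closed_Int closed_atLeastAtMost) auto
      show "continuous_map (subtopology (top_of_set ({0..1} \<times> ?A))
            (({0..1} \<inter> (if b then {..c n} else {c n..})) \<times> ?A)) Z
          (if b then (\<lambda>(\<tau>, a). v (Suc n) x \<tau> a) else (\<lambda>(\<tau>, a). R (Suc n) x \<tau> (boundary_push (Suc n) a)))" for b
      proof (cases b)
        case True
        then show ?thesis using cont_early[OF Suc.prems]
          by (simp add: subtopology_subtopology inf.absorb2 Sigma_mono)
      next
        case False
        have "continuous_map (top_of_set ({0..1} \<times> ?A)) Z (\<lambda>(\<tau>, a). R (Suc n) x \<tau> (boundary_push (Suc n) a))"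
          by (rule continuous_map_second_factor[OF continuous_on_boundary_push push_B cB])
        then show ?thesis using False
          by (simp add: continuous_map_from_subtopology)
      qed
      show "(if b then (\<lambda>(\<tau>, a). v (Suc n) x \<tau> a) else (\<lambda>(\<tau>, a). R (Suc n) x \<tau> (boundary_push (Suc n) a))) p
          = (if b' then (\<lambda>(\<tau>, a). v (Suc n) x \<tau> a) else (\<lambda>(\<tau>, a). R (Suc n) x \<tau> (boundary_push (Suc n) a))) p"
        if "p \<in> topspace (top_of_set ({0..1} \<times> ?A)) \<inter> ({0..1} \<inter> (if b then {..c n} else {c n..})) \<times> ?A
           \<inter> ({0..1} \<inter> (if b' then {..c n} else {c n..})) \<times> ?A" for b b' p
        using that R_stop[OF Suc.prems nd, of "snd p" "fst p"] R_boundary_push[OF Suc.prems nd, of "snd p" "fst p"]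
        by (cases b; cases b') auto
      show "\<exists>b. b \<in> UNIV \<and> p \<in> ({0..1} \<inter> (if b then {..c n} else {c n..})) \<times> ?A \<and>
          (case p of (\<tau>, a) \<Rightarrow> R (Suc n) x \<tau> a) =
          (if b then (\<lambda>(\<tau>, a). v (Suc n) x \<tau> a) else (\<lambda>(\<tau>, a). R (Suc n) x \<tau> (boundary_push (Suc n) a))) p"
        if "p \<in> topspace (top_of_set ({0..1} \<times> ?A))" for p
        using that R_stop[OF Suc.prems nd, of "snd p" "fst p"] R_boundary_push[OF Suc.prems nd, of "snd p" "fst p"]
        by (intro exI[of _ "fst p \<le> c n"]) auto
    qed auto
  qed
qed

text \<open>The recursion is constant along the relation defining the colimit, hence descends to it.\<close>
lemma collapse_extension:
  obtains k where "\<And>\<tau> n x a. k \<tau> (realization_class X affine_simplex (n, x) a) = R n x \<tau> a"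
    and "continuous_map (prod_topology (top_of_set {0..1}) (affine_realization X)) Z (\<lambda>(\<tau>, q). k \<tau> q)"
proof -
  have "\<exists>k. \<forall>n x a. k (realization_class X affine_simplex (n, x) a) = R n x \<tau> a" for \<tau>
  proof -
    obtain k where "\<And>n x a. k (realization_class X affine_simplex (n, x) a)
        = (\<lambda>(n, x) a. R n x \<tau> a) (n, x) a"
      by (rule realization_desc[where F = affine_simplex and X = X and h = "\<lambda>(n, x) a. R n x \<tau> a"])
        (use collapse_value_natural[OF X] in auto)
    then show ?thesis by auto
  qed
  then obtain k where k: "\<And>\<tau> n x a. k \<tau> (realization_class X affine_simplex (n, x) a) = R n x \<tau> a"
    by metis
  have "continuous_map (prod_topology (top_of_set {0..1}) (affine_realization X)) Z (\<lambda>(\<tau>, q). k \<tau> q)"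
    unfolding affine_realization_def
  proof (rule continuous_map_prod_final_topology)
    fix i assume "i \<in> all_simplices X"
    then obtain n x where i: "i = (n, x)" "x \<in> simplices X n" by auto
    then show "realization_class X affine_simplex i
        \<in> topspace (case i of (n, x) \<Rightarrow> subtopology (powertop_real UNIV) (affine_simplex n))
          \<rightarrow> realization_points X affine_simplex"
      by (auto simp: realization_points_def)
    show "continuous_map (prod_topology (top_of_set {0..1})
        (case i of (n, x) \<Rightarrow> subtopology (powertop_real UNIV) (affine_simplex n))) Z
        (\<lambda>(\<tau>, a). k \<tau> (realization_class X affine_simplex i a))"
      using continuous_map_R[OF i(2)] by (simp add: i k euclidean_product_topology)
  qed (auto simp: realization_points_def)
  then show thesis using k that by blast
qed

end


section \<open>Deformation onto the geometric realization\<close>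

lemma realization_class_in_points:
  "x \<in> simplices X n \<Longrightarrow> a \<in> F n \<Longrightarrow> realization_class X F (n, x) a \<in> realization_points X F"
  unfolding realization_points_def by blast

lemma topspace_affine_realization: "topspace (affine_realization X) = realization_points X affine_simplex"
  unfolding affine_realization_def by (rule topspace_final_topology) (auto intro: realization_class_in_points)

lemma topspace_geom_realization: "topspace (geom_realization X) = realization_points X standard_simplex"
  unfolding geom_realization_def by (rule topspace_final_topology) (auto intro: realization_class_in_points)

lemma continuous_map_class_affine:
  assumes "x \<in> simplices X n"
  shows "continuous_map (top_of_set (affine_simplex n)) (affine_realization X)
           (realization_class X affine_simplex (n, x))"
  using continuous_map_coprojection[of "(n, x)" "all_simplices X" "realization_class X affine_simplex"
      "\<lambda>(n, x). subtopology (powertop_real UNIV) (affine_simplex n)" "realization_points X affine_simplex"]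
    assms
  by (force simp: affine_realization_def euclidean_product_topology intro: realization_class_in_points)

lemma continuous_map_class_standard:
  assumes "x \<in> simplices X n"
  shows "continuous_map (top_of_set (standard_simplex n)) (geom_realization X)
           (realization_class X standard_simplex (n, x))"
  using continuous_map_coprojection[of "(n, x)" "all_simplices X" "realization_class X standard_simplex"
      "\<lambda>(n, x). subtopology (powertop_real UNIV) (standard_simplex n)"
      "realization_points X standard_simplex"]
    assms
  by (force simp: geom_realization_def euclidean_product_topology intro: realization_class_in_points)

text \<open>With a negative bound the recursion stops only in standard simplices, which defines the
  retraction; the time parameter is irrelevant.\<close>
lemma collapse_retraction:
  assumes X: "simplicial_set X"
  shows "collapse X (\<lambda>_. - 1) (\<lambda>n x \<tau> a. realization_class X standard_simplex (n, x) a)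
           (geom_realization X)"
proof
  show "simplicial_set X" by (rule X)
  show "continuous_map (top_of_set ({0..1 :: real} \<times> standard_simplex n)) (geom_realization X)
      (\<lambda>(\<tau>, a). realization_class X standard_simplex (n, x) a)" if "x \<in> simplices X n" for n x
    by (intro continuous_map_snd_factor continuous_map_class_standard that)
  show "realization_class X standard_simplex (Suc n, x) a = realization_class X standard_simplex (n, y) b"
    if "reduces X n (x, a) (y, b)" "a \<in> standard_simplex (Suc n)" for n x a y b
    by (rule reduces_imp_class_eq(2)[OF X that])
  \<comment> \<open>The conditions at early times are vacuous.\<close>
  have empty: "{0..1} \<inter> {..- 1} = ({} :: real set)" by auto
  show "continuous_map (top_of_set (({0..1 :: real} \<inter> {..- 1}) \<times> affine_simplex (Suc n))) (geom_realization X)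
      (\<lambda>(\<tau>, a). realization_class X standard_simplex (Suc n, x) a)" for n x
    unfolding empty by (simp add: continuous_map_def)
qed auto

text \<open>The progress of the push in dimension \<open>n\<close>: it starts at time \<open>1/2\<^sup>n\<^sup>+\<^sup>1\<close> and is complete at time \<open>1/2\<^sup>n\<close>,
  so that higher dimensions are pushed before lower ones.\<close>
definition ramp :: "nat \<Rightarrow> real \<Rightarrow> real" where
  "ramp n \<tau> = max 0 (min 1 (2 ^ Suc n * \<tau> - 1))"

text \<open>The point at time \<open>\<tau>\<close> on the segment from \<open>a\<close> to its push.\<close>
definition slide :: "nat \<Rightarrow> real \<Rightarrow> (nat \<Rightarrow> real) \<Rightarrow> nat \<Rightarrow> real" where
  "slide n \<tau> a = (\<lambda>i. (1 - ramp n \<tau>) * a i + ramp n \<tau> * boundary_push n a i)"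

lemma slide_fixed: "boundary_push n a = a \<Longrightarrow> slide n \<tau> a = a"
  by (simp add: slide_def fun_eq_iff algebra_simps)

lemma slide_early: "\<tau> \<le> 1 / 2 ^ Suc n \<Longrightarrow> slide n \<tau> a = a"
proof -
  assume "\<tau> \<le> 1 / 2 ^ Suc n"
  then have "2 ^ Suc n * \<tau> \<le> 1" by (simp add: field_simps)
  then have "ramp n \<tau> = 0" by (simp add: ramp_def)
  then show ?thesis by (simp add: slide_def)
qed

lemma slide_end: "slide (Suc n) (1 / 2 ^ Suc n) a = boundary_push (Suc n) a"
  by (simp add: slide_def ramp_def)

lemma slide_in_affine:
  assumes "a \<in> affine_simplex n" shows "slide n \<tau> a \<in> affine_simplex n"
  using assms boundary_push_in_affine[OF assms]
  by (auto simp: affine_simplex_iff slide_def sum.distrib simp flip: sum_distrib_left)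

lemma continuous_on_slide:
  "continuous_on (K \<times> affine_simplex n) (\<lambda>(\<tau>, a). slide n \<tau> a)"
proof -
  let ?A = "K \<times> affine_simplex n"
  have r: "continuous_on ?A (\<lambda>p. ramp n (fst p))"
    unfolding ramp_def
    by (intro continuous_on_max continuous_on_min continuous_on_diff continuous_on_mult
        continuous_on_fst continuous_on_id continuous_on_const)
  have a: "continuous_on ?A (\<lambda>p. snd p i)" for i
    by (rule continuous_on_compose2[OF continuous_on_coord[of UNIV]])
      (auto intro: continuous_on_snd continuous_on_id)
  have "continuous_on ?A (\<lambda>p. boundary_push n (snd p))"
    by (rule continuous_on_compose2[OF continuous_on_boundary_push]) (auto intro: continuous_on_snd continuous_on_id)
  then have b: "continuous_on ?A (\<lambda>p. boundary_push n (snd p) i)" for i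
    by (rule continuous_on_product_then_coordinatewise)
  show ?thesis
    unfolding slide_def case_prod_unfold
    by (intro continuous_on_coordinatewise_then_product continuous_on_add continuous_on_mult
        continuous_on_diff continuous_on_const r a b)
qed

lemma collapse_homotopy:
  assumes X: "simplicial_set X"
  shows "collapse X (\<lambda>n. 1 / 2 ^ Suc n)
           (\<lambda>n x \<tau> a. realization_class X affine_simplex (n, x) (slide n \<tau> a)) (affine_realization X)"
proof
  let ?v = "\<lambda>n x \<tau> a. realization_class X affine_simplex (n, x) (slide n \<tau> a)"
  have cont: "continuous_map (top_of_set (K \<times> affine_simplex n)) (affine_realization X)
      (\<lambda>(\<tau>, a). ?v n x \<tau> a)" if "x \<in> simplices X n" for K n x
  proof -
    have "continuous_map (top_of_set (K \<times> affine_simplex n)) (top_of_set (affine_simplex n))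
        (\<lambda>(\<tau>, a). slide n \<tau> a)"
      using continuous_on_slide slide_in_affine by (force simp: continuous_map_in_subtopology)
    from continuous_map_compose[OF this continuous_map_class_affine[OF that]]
    show ?thesis by (simp add: o_def case_prod_unfold)
  qed
  show "simplicial_set X" by (rule X)
  show "1 / 2 ^ Suc (Suc n) \<le> (1 / 2 ^ Suc n :: real)" for n by (simp add: field_simps)
  show "continuous_map (top_of_set ({0..1 :: real} \<times> standard_simplex n)) (affine_realization X)
      (\<lambda>(\<tau>, a). ?v n x \<tau> a)" if "x \<in> simplices X n" for n x
    using continuous_map_from_subtopology_mono[OF cont[OF that, of "{0..1}"]] standard_subset_affine
    by (metis Sigma_mono order_refl)
  show "?v (Suc n) x \<tau> a = ?v n y \<tau> b"
    if r: "reduces X n (x, a) (y, b)" and a: "a \<in> standard_simplex (Suc n)" for n x a y b \<tau>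
    using reduces_imp_class_eq(1)[OF X r] reduces_target(3)[OF X r a] a by (simp add: slide_fixed boundary_push_standard)
  show "continuous_map (top_of_set (({0..1} \<inter> {..1 / 2 ^ Suc n}) \<times> affine_simplex (Suc n)))
      (affine_realization X) (\<lambda>(\<tau>, a). ?v (Suc n) x \<tau> a)" if "x \<in> simplices X (Suc n)" for n x
    by (rule cont[OF that])
  show "?v (Suc n) x \<tau> a = ?v n y \<tau> b"
    if r: "reduces X n (x, a) (y, b)" and
      \<tau>: "\<tau> \<le> 1 / 2 ^ Suc (Suc n) \<or> \<tau> \<le> 1 / 2 ^ Suc n \<and> (\<exists>i\<le>Suc n. a i = 0)" for n x a y b \<tau>
  proof -
    have "slide (Suc n) \<tau> a = a" using \<tau> slide_early slide_fixed boundary_push_boundary by metis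
    moreover have "1 / 2 ^ Suc (Suc n) \<le> (1 / 2 ^ Suc n :: real)" by (simp add: field_simps)
    then have "slide n \<tau> b = b" using \<tau> by (intro slide_early) linarith
    ultimately show ?thesis using reduces_imp_class_eq(1)[OF X r] by simp
  qed
  show "?v (Suc n) x (1 / 2 ^ Suc n) (boundary_push (Suc n) a) = ?v (Suc n) x (1 / 2 ^ Suc n) a"
    if a: "a \<in> affine_simplex (Suc n)" for n x a
  proof -
    have "boundary_push (Suc n) (boundary_push (Suc n) a) = boundary_push (Suc n) a"
      using boundary_push_standard[of a "Suc n"] boundary_push_hits_boundary[OF a] boundary_push_boundary[of _ "Suc n" "boundary_push (Suc n) a"]
      by (cases "a \<in> standard_simplex (Suc n)") auto
    then show ?thesis by (simp only: slide_end slide_fixed)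
  qed
qed

text \<open>At time 1 every push is complete, so that the two recursions take the same path.\<close>
lemma collapse_value_end:
  assumes X: "simplicial_set X"
    and \<iota>: "\<And>n x a. \<iota> (realization_class X standard_simplex (n, x) a) = realization_class X affine_simplex (n, x) a"
  shows "x \<in> simplices X n \<Longrightarrow> a \<in> affine_simplex n \<Longrightarrow>
    collapse_value X (\<lambda>n. 1 / 2 ^ Suc n) (\<lambda>n x \<tau> a. realization_class X affine_simplex (n, x) (slide n \<tau> a)) n x 1 a
    = \<iota> (collapse_value X (\<lambda>_. - 1) (\<lambda>n x \<tau> a. realization_class X standard_simplex (n, x) a) n x 1 a)"
proof (induction n arbitrary: x a)
  case 0
  then show ?case by (simp add: \<iota> affine_simplex_0 slide_fixed boundary_push_standard)
next
  case (Suc n)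
  have "1 < (2 :: real) ^ Suc n" by (rule one_less_power) auto
  then have late: "\<not> (1 \<le> 1 / (2 ^ Suc n :: real))" by (simp add: field_simps)
  have some: "fst (SOME t. reduces X n (x, b) t) \<in> simplices X n"
    "snd (SOME t. reduces X n (x, b) t) \<in> affine_simplex n" if "\<exists>t. reduces X n (x, b) t" for b
    using reduces_target(1,2)[OF X, of n x b "fst (SOME t. reduces X n (x, b) t)" "snd (SOME t. reduces X n (x, b) t)"]
      someI_ex[OF that] by auto
  consider "\<exists>t. reduces X n (x, a) t"
    | "\<nexists>t. reduces X n (x, a) t" "a \<in> standard_simplex (Suc n)"
    | "\<nexists>t. reduces X n (x, a) t" "a \<notin> standard_simplex (Suc n)" by blast
  then show ?case
  proof cases
    case 1
    then show ?thesis using Suc.IH[OF some[OF 1]] by (simp add: collapse_value.simps(2) Let_def)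
  next
    case 2
    then show ?thesis by (simp add: collapse_value.simps(2) \<iota> slide_fixed boundary_push_standard)
  next
    case 3
    obtain i where "i \<le> Suc n" "boundary_push (Suc n) a i = 0" using boundary_push_hits_boundary[OF Suc.prems(2) 3(2)] by blast
    then have "\<exists>t. reduces X n (x, boundary_push (Suc n) a) t"
      using reduces_faceI[OF Suc.prems(1) boundary_push_in_affine[OF Suc.prems(2)]] by blast
    from Suc.IH[OF some[OF this]] show ?thesis
      using 3 late by (simp only: collapse_value.simps(2) Let_def if_False simp_thms) simp
  qed
qed

text \<open>The inclusion \<open>\<iota>\<close> of the geometric realization, its retraction \<open>r\<close>, and the homotopy \<open>h\<close> from the
  identity to \<open>\<iota> \<circ> r\<close> relative to the geometric realization.\<close>
lemma exists_deformation:
  fixes X :: "'a simp_set"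
  assumes X: "simplicial_set X"
  obtains \<iota> r h where
    "continuous_map (geom_realization X) (affine_realization X) \<iota>"
    "continuous_map (affine_realization X) (geom_realization X) r"
    "continuous_map (prod_topology (top_of_set {0..1}) (affine_realization X)) (affine_realization X)
       (\<lambda>(\<tau>, q). h (\<tau>::real) q)"
    "\<And>p. p \<in> topspace (geom_realization X) \<Longrightarrow> r (\<iota> p) = p"
    "\<And>q. q \<in> topspace (affine_realization X) \<Longrightarrow> h 0 q = q"
    "\<And>q. q \<in> topspace (affine_realization X) \<Longrightarrow> h 1 q = \<iota> (r q)"
    "\<And>\<tau> p. p \<in> topspace (geom_realization X) \<Longrightarrow> h \<tau> (\<iota> p) = \<iota> p"
proof -
  let ?A = "realization_class X affine_simplex" and ?S = "realization_class X standard_simplex"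
  interpret ret: collapse X "\<lambda>_. - 1" "\<lambda>n x \<tau> a. ?S (n, x) a" "geom_realization X"
    by (rule collapse_retraction[OF X])
  interpret hom: collapse X "\<lambda>n. 1 / 2 ^ Suc n" "\<lambda>n x \<tau> a. ?A (n, x) (slide n \<tau> a)" "affine_realization X"
    by (rule collapse_homotopy[OF X])
  have "?A (m, act X m n f y) a = ?A (n, y) (push_coords m f a)"
    if "f \<in> simplex_maps m n" "y \<in> simplices X n" "a \<in> standard_simplex m" for m n f y a
    by (rule realization_class_glue[where F = affine_simplex, OF that(1,2) subsetD[OF standard_subset_affine that(3)]])
  from realization_desc[where F = standard_simplex and X = X and h = ?A, OF this]
  obtain \<iota> where \<iota>: "\<And>n x a. \<iota> (?S (n, x) a) = ?A (n, x) a" by auto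
  obtain k where k: "\<And>\<tau> n x a. k \<tau> (?A (n, x) a) = ret.R n x \<tau> a"
    and k_cont: "continuous_map (prod_topology (top_of_set {0..1}) (affine_realization X))
      (geom_realization X) (\<lambda>(\<tau>, q). k \<tau> q)"
    by (rule ret.collapse_extension) blast
  obtain h where h: "\<And>\<tau> n x a. h \<tau> (?A (n, x) a) = hom.R n x \<tau> a"
    and h_cont: "continuous_map (prod_topology (top_of_set {0..1}) (affine_realization X))
      (affine_realization X) (\<lambda>(\<tau>, q). h \<tau> q)"
    by (rule hom.collapse_extension) blast
  show thesis
  proof (rule that[of \<iota> "k 1" h])
    show "continuous_map (geom_realization X) (affine_realization X) \<iota>"
      unfolding geom_realization_def
    proof (rule continuous_map_from_final_topology)
      fix i assume "i \<in> all_simplices X"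
      then obtain n x where i: "i = (n, x)" "x \<in> simplices X n" by auto
      have "continuous_map (top_of_set (standard_simplex n)) (affine_realization X) (?A (n, x))"
        using continuous_map_from_subtopology_mono[OF continuous_map_class_affine[OF i(2)]]
          standard_subset_affine by blast
      then show "continuous_map (case i of (n, x) \<Rightarrow> subtopology (powertop_real UNIV) (standard_simplex n))
          (affine_realization X) (\<lambda>a. \<iota> (?S i a))"
        by (simp add: i \<iota> euclidean_product_topology)
    next
      fix i assume "i \<in> all_simplices X"
      then show "?S i \<in> topspace (case i of (n, x) \<Rightarrow> subtopology (powertop_real UNIV) (standard_simplex n))
          \<rightarrow> realization_points X standard_simplex"
        by (auto intro: realization_class_in_points)
    qed (auto simp: realization_points_def)
    have "continuous_map (affine_realization X) (prod_topology (top_of_set {0..1}) (affine_realization X))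
        (\<lambda>q. (1 :: real, q))" by (intro continuous_map_pairedI) auto
    from continuous_map_compose[OF this k_cont]
    show "continuous_map (affine_realization X) (geom_realization X) (k 1)" by (simp add: o_def)
    show "continuous_map (prod_topology (top_of_set {0..1}) (affine_realization X))
      (affine_realization X) (\<lambda>(\<tau>, q). h \<tau> q)" by (rule h_cont)
  next
    fix p assume "p \<in> topspace (geom_realization X)"
    then obtain n x a where p: "p = ?S (n, x) a" "x \<in> simplices X n" "a \<in> standard_simplex n"
      by (auto simp: topspace_geom_realization realization_points_def)
    show "k 1 (\<iota> p) = p" using ret.R_standard[OF p(2,3)] by (simp add: p(1) \<iota> k)
    show "h \<tau> (\<iota> p) = \<iota> p" for \<tau>
      using hom.R_standard[OF p(2,3)] p(3) by (simp add: p(1) \<iota> h slide_fixed boundary_push_standard)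
  next
    fix q assume "q \<in> topspace (affine_realization X)"
    then obtain n x a where q: "q = ?A (n, x) a" "x \<in> simplices X n" "a \<in> affine_simplex n"
      by (auto simp: topspace_affine_realization realization_points_def)
    show "h 0 q = q" using hom.R_early[OF q(2,3), of 0] slide_early[of 0 n a] by (simp add: q(1) h)
    show "h 1 q = \<iota> (k 1 q)" using collapse_value_end[where \<iota> = \<iota>, OF X \<iota> q(2,3)] by (simp add: q(1) h k)
  qed
qed


section \<open>The D-topology of the diffeological realization\<close>

text \<open>The diffeology on a topological space whose plots are the continuous maps.\<close>
definition continuous_diffeology :: "'a topology \<Rightarrow> 'a diffeo_space" where
  "continuous_diffeology T =
     \<lparr>dcarrier = topspace T,
      plots = \<lambda>n U. {p \<in> extensional U. openin (Euclidean_space n) U \<and>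
        continuous_map (subtopology (Euclidean_space n) U) T p}\<rparr>"

lemma smooth_between_imp_continuous:
  assumes "smooth_between m V n U g"
  shows "continuous_map (subtopology (Euclidean_space m) V) (subtopology (Euclidean_space n) U) g"
proof -
  have V: "openin (Euclidean_space m) V" "V \<subseteq> topspace (Euclidean_space m)"
    and U: "U \<subseteq> topspace (Euclidean_space n)" and g: "g \<in> V \<rightarrow> U"
    and C: "\<And>j. j < n \<Longrightarrow> C_k_on 0 m V (\<lambda>x. g x j)"
    using assms openin_subset by (auto simp: smooth_between_def simp del: C_k_on.simps)
  have "continuous_map (subtopology (Euclidean_space m) V) (Euclidean_space n)
      (\<lambda>x j. if j < n then g x j else 0)"
    using C by (simp add: continuous_map_componentwise_Euclidean_space)
  moreover have "(\<lambda>j. if j < n then g x j else 0) = g x" if "x \<in> V" for x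
  proof -
    have "g x \<in> topspace (Euclidean_space n)" using g U that by auto
    then show ?thesis by (auto simp: topspace_Euclidean_space fun_eq_iff)
  qed
  ultimately have "continuous_map (subtopology (Euclidean_space m) V) (Euclidean_space n) g"
    by (rule continuous_map_eq) simp
  then show ?thesis using g by (auto simp: continuous_map_in_subtopology)
qed

lemma diffeological_space_continuous_diffeology: "diffeological_space (continuous_diffeology T)"
proof (rule diffeological_spaceI)
  fix n U p assume p: "p \<in> plots (continuous_diffeology T) n U"
  then show U: "openin (Euclidean_space n) U" by (simp add: continuous_diffeology_def)
  show "p \<in> U \<rightarrow>\<^sub>E dcarrier (continuous_diffeology T)"
    using p openin_subset[OF U]
      continuous_map_image_subset_topspace[of "subtopology (Euclidean_space n) U" T p]
    by (auto simp: continuous_diffeology_def PiE_def inf.absorb2)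
next
  fix n U y assume "openin (Euclidean_space n) U" "y \<in> dcarrier (continuous_diffeology T)"
  moreover have "continuous_map (subtopology (Euclidean_space n) U) T (\<lambda>u\<in>U. y)" if "y \<in> topspace T"
    by (rule continuous_map_eq[of _ _ "\<lambda>_. y"]) (use that in auto)
  ultimately show "(\<lambda>u\<in>U. y) \<in> plots (continuous_diffeology T) n U"
    by (simp add: continuous_diffeology_def)
next
  fix n U p m V g assume p: "p \<in> plots (continuous_diffeology T) n U" and g: "smooth_between m V n U g"
  have "continuous_map (subtopology (Euclidean_space n) U) T p"
    using p by (simp add: continuous_diffeology_def)
  then have "continuous_map (subtopology (Euclidean_space m) V) T (p \<circ> g)"
    by (rule continuous_map_compose[OF smooth_between_imp_continuous[OF g]])
  then have "continuous_map (subtopology (Euclidean_space m) V) T (compose V p g)"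
    by (rule continuous_map_eq) (simp add: compose_def)
  then show "compose V p g \<in> plots (continuous_diffeology T) m V"
    using g by (simp add: continuous_diffeology_def smooth_between_def)
next
  fix n U p \<V> assume U: "openin (Euclidean_space n) U" and p: "p \<in> U \<rightarrow>\<^sub>E dcarrier (continuous_diffeology T)"
    and \<V>: "\<And>V. V \<in> \<V> \<Longrightarrow> openin (Euclidean_space n) V \<and> restrict p V \<in> plots (continuous_diffeology T) n V"
    and un: "\<Union>\<V> = U"
  have "continuous_map (subtopology (Euclidean_space n) U) T p"
  proof (rule pasting_lemma[where I = \<V> and T = "\<lambda>V. V" and f = "\<lambda>_. p"])
    fix V assume V: "V \<in> \<V>"
    then have VU: "V \<subseteq> U" using un by blast
    show "openin (subtopology (Euclidean_space n) U) V"
      using \<V>[OF V] VU by (simp add: openin_open_subtopology U)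
    have "continuous_map (subtopology (Euclidean_space n) V) T (restrict p V)"
      using \<V>[OF V] by (simp add: continuous_diffeology_def)
    then have "continuous_map (subtopology (Euclidean_space n) V) T p"
      by (rule continuous_map_eq) simp
    then show "continuous_map (subtopology (subtopology (Euclidean_space n) U) V) T p"
      using VU by (simp add: subtopology_subtopology inf.absorb2)
  qed (use un in auto)
  then show "p \<in> plots (continuous_diffeology T) n U"
    using U p by (simp add: continuous_diffeology_def PiE_def)
qed

lemma C_k_on_const: "C_k_on k n U (\<lambda>_. c)"
proof (induction k arbitrary: c)
  case (Suc k)
  show ?case using Suc[of 0] by (auto intro!: exI[of _ "\<lambda>_ _. 0"])
qed simp

lemma continuous_map_Euclidean_coord:
  "continuous_map (subtopology (Euclidean_space n) U) euclideanreal (\<lambda>x. x i)"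
  unfolding Euclidean_space_def
  by (intro continuous_map_from_subtopology continuous_map_product_projection) simp

lemma C_k_on_affine:
  assumes "finite I"
  shows "C_k_on k n U (\<lambda>x. c + (\<Sum>i\<in>I. w i * x i))"
proof (cases k)
  case 0
  then show ?thesis
    by (auto intro!: continuous_map_add continuous_map_sum continuous_map_real_mult
        continuous_map_Euclidean_coord assms)
next
  case (Suc k')
  have "((\<lambda>t. c + (\<Sum>l\<in>I. w l * (x(i := t)) l)) has_real_derivative (if i \<in> I then w i else 0)) (at (x i))"
    for i x
  proof -
    have "((\<lambda>t. c + (\<Sum>l\<in>I. w l * (x(i := t)) l)) has_real_derivative
        0 + (\<Sum>l\<in>I. if l = i then w i else 0)) (at (x i))"
      by (intro derivative_intros) (auto intro!: derivative_eq_intros)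
    then show ?thesis using assms by (simp add: if_distrib cong: if_cong)
  qed
  then show ?thesis unfolding Suc
    by (auto intro!: exI[of _ "\<lambda>i _. if i \<in> I then w i else 0"] C_k_on_const continuous_map_add
        continuous_map_sum continuous_map_real_mult continuous_map_Euclidean_coord assms)
qed

text \<open>Partial derivatives of \<open>f\<close> involve the points \<open>x(i := t)\<close> for all real \<open>t\<close>; on the whole
  Euclidean space they stay in the domain.\<close>
lemma C_k_on_cong:
  assumes g: "C_k_on k m (topspace (Euclidean_space m)) g"
    and eq: "\<And>x. x \<in> topspace (Euclidean_space m) \<Longrightarrow> f x = g x"
  shows "C_k_on k m (topspace (Euclidean_space m)) f"
proof -
  have c: "continuous_map (subtopology (Euclidean_space m) (topspace (Euclidean_space m))) euclideanreal f"
    if "continuous_map (subtopology (Euclidean_space m) (topspace (Euclidean_space m))) euclideanreal g"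
    by (rule continuous_map_eq[OF that]) (simp add: eq)
  have "(\<lambda>t. f (x(i := t))) = (\<lambda>t. g (x(i := t)))" if "x \<in> topspace (Euclidean_space m)" "i < m" for x i
    using that by (intro ext eq) (auto simp: topspace_Euclidean_space)
  then show ?thesis using g c by (cases k) auto
qed

text \<open>A smooth retraction of Euclidean \<open>(n + 1)\<close>-space onto the affine simplex: the coordinate 0 is
  replaced by the value that makes the sum 1.\<close>
definition affine_projection :: "nat \<Rightarrow> (nat \<Rightarrow> real) \<Rightarrow> nat \<Rightarrow> real" where
  "affine_projection n a = (\<lambda>i. if i = 0 then 1 - (\<Sum>k\<in>{1..n}. a k) else if i \<le> n then a i else 0)"

lemma atMost_eq_insert_0: "{..n::nat} = insert 0 {1..n}" by auto

lemma affine_projection_in: "affine_projection n a \<in> affine_simplex n"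
proof -
  have "(\<Sum>i\<in>{1..n}. affine_projection n a i) = (\<Sum>k\<in>{1..n}. a k)"
    by (intro sum.cong) (auto simp: affine_projection_def)
  then show ?thesis
    by (simp add: affine_simplex_iff atMost_eq_insert_0) (simp add: affine_projection_def)
qed

lemma affine_projection_id: "a \<in> affine_simplex n \<Longrightarrow> affine_projection n a = a"
  by (auto simp: affine_simplex_iff atMost_eq_insert_0 affine_projection_def fun_eq_iff not_le)

lemma affine_projection_plot:
  "restrict (affine_projection n) (topspace (Euclidean_space (Suc n)))
     \<in> plots (affine_simplex_diff n) (Suc n) (topspace (Euclidean_space (Suc n)))"
proof -
  let ?U = "topspace (Euclidean_space (Suc n))"
  have "C_k_on k (Suc n) ?U (\<lambda>x. restrict (affine_projection n) ?U x j)" if "j < Suc n" for j k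
  proof (cases "j = 0")
    case True
    have "C_k_on k (Suc n) ?U (\<lambda>x. 1 + (\<Sum>i\<in>{1..n}. (- 1) * x i))" by (rule C_k_on_affine) simp
    then show ?thesis
      by (rule C_k_on_cong) (auto simp: True affine_projection_def sum_negf)
  next
    case False
    have "C_k_on k (Suc n) ?U (\<lambda>x. 0 + (\<Sum>i\<in>{j}. 1 * x i))" by (rule C_k_on_affine) simp
    then show ?thesis
      by (rule C_k_on_cong) (use False that in \<open>auto simp: affine_projection_def\<close>)
  qed
  then show ?thesis
    using affine_projection_in
    by (auto simp: affine_simplex_diff_def sub_diffeology_def euclidean_diff_def smooth_between_def
        affine_simplex_def)
qed

lemma diff_smooth_class_continuous_diffeology:
  assumes "x \<in> simplices X n"
  shows "diff_smooth (affine_simplex_diff n) (continuous_diffeology (affine_realization X))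
           (realization_class X affine_simplex (n, x))"
  unfolding diff_smooth_def
proof (intro conjI allI impI)
  let ?c = "realization_class X affine_simplex (n, x)" and ?T = "affine_realization X"
  \<comment> \<open>The subspace topologies from Euclidean space and from the full product agree.\<close>
  have c: "continuous_map (subtopology (Euclidean_space (Suc n)) (affine_simplex n)) ?T ?c"
  proof -
    have "affine_simplex n \<subseteq> {a. \<forall>i\<ge>Suc n. a i = 0}"
      by (auto simp: affine_simplex_iff)
    then show ?thesis
      using continuous_map_class_affine[OF assms]
      by (simp add: Euclidean_space_def subtopology_subtopology inf.absorb2 euclidean_product_topology)
  qed
  show "?c \<in> dcarrier (affine_simplex_diff n) \<rightarrow> dcarrier (continuous_diffeology ?T)"
    using assms by (auto simp: dcarrier_affine_simplex_diff continuous_diffeology_def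
        topspace_affine_realization intro: realization_class_in_points)
  fix m V q assume q: "q \<in> plots (affine_simplex_diff n) m V"
  then have s: "smooth_between m V (Suc n) (topspace (Euclidean_space (Suc n))) q"
    and qA: "q \<in> V \<rightarrow> affine_simplex n"
    by (auto simp: affine_simplex_diff_def sub_diffeology_def euclidean_diff_def PiE_def)
  have "continuous_map (subtopology (Euclidean_space m) V)
      (subtopology (Euclidean_space (Suc n)) (affine_simplex n)) q"
    using smooth_between_imp_continuous[OF s] qA
    by (auto simp: continuous_map_in_subtopology)
  from continuous_map_compose[OF this c]
  have "continuous_map (subtopology (Euclidean_space m) V) ?T (compose V ?c q)"
    by (rule continuous_map_eq) (simp add: compose_def)
  then show "compose V ?c q \<in> plots (continuous_diffeology ?T) m V"
    using s by (simp add: continuous_diffeology_def smooth_between_def)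
qed

lemma D_topology_diff_realization: "D_topology (diff_realization X) = affine_realization X"
proof (unfold topology_eq, intro allI iffI)
  fix W assume W: "openin (D_topology (diff_realization X)) W"
  have W_plot: "openin (subtopology (Euclidean_space n) U)
      {a \<in> topspace (subtopology (Euclidean_space n) U). p a \<in> W}"
    if "p \<in> plots (diff_realization X) n U" for n U p
    using W that by (force simp: D_topology_def openin_final_topology)
  show "openin (affine_realization X) W"
    unfolding affine_realization_def openin_final_topology
  proof (intro conjI ballI)
    show "W \<subseteq> realization_points X affine_simplex"
      using W by (simp add: D_topology_def openin_final_topology diff_realization_def final_diffeology_def)
    fix i assume "i \<in> all_simplices X"
    then obtain n x where i: "i = (n, x)" "x \<in> simplices X n" by auto
    let ?E = "Euclidean_space (Suc n)" and ?c = "realization_class X affine_simplex (n, x)"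
    \<comment> \<open>A plot on the whole Euclidean space that restricts to the coprojection on the simplex.\<close>
    let ?p = "compose (topspace ?E) ?c (restrict (affine_projection n) (topspace ?E))"
    have "?p \<in> plots (diff_realization X) (Suc n) (topspace ?E)"
      using diff_realization_cocone[OF i(2)] affine_projection_plot
      by (simp add: diff_smooth_def)
    then have "openin (subtopology ?E (topspace ?E))
        {a \<in> topspace (subtopology ?E (topspace ?E)). ?p a \<in> W}"
      by (rule W_plot)
    then have "openin (subtopology ?E (affine_simplex n)) (affine_simplex n \<inter> {a \<in> topspace ?E. ?p a \<in> W})"
      by (simp add: openin_subtopology_Int2)
    moreover have A: "affine_simplex n \<subseteq> topspace ?E" by (auto simp: affine_simplex_def)
    then have "affine_simplex n \<inter> {a \<in> topspace ?E. ?p a \<in> W} = {a \<in> affine_simplex n. ?c a \<in> W}"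
      by (auto simp: compose_def affine_projection_id)
    moreover have "subtopology ?E (affine_simplex n) = subtopology (powertop_real UNIV) (affine_simplex n)"
      using A by (simp add: Euclidean_space_def subtopology_subtopology inf.absorb2 topspace_Euclidean_space)
    ultimately show "openin (case i of (n, x) \<Rightarrow> subtopology (powertop_real UNIV) (affine_simplex n))
        {a \<in> topspace (case i of (n, x) \<Rightarrow> subtopology (powertop_real UNIV) (affine_simplex n)).
           realization_class X affine_simplex i a \<in> W}"
      by (simp add: i)
  qed
next
  fix W assume W: "openin (affine_realization X) W"
  let ?Z = "continuous_diffeology (affine_realization X)"
  have "diffeological_space ?Z" by (rule diffeological_space_continuous_diffeology)
  moreover have "dcarrier ?Z = realization_points X affine_simplex"
    by (simp add: continuous_diffeology_def topspace_affine_realization)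
  moreover have "\<forall>i\<in>all_simplices X. diff_smooth (case i of (n, x) \<Rightarrow> affine_simplex_diff n) ?Z
       (realization_class X affine_simplex i)"
    using diff_smooth_class_continuous_diffeology by auto
  ultimately have p: "p \<in> plots ?Z n U" if "p \<in> plots (diff_realization X) n U" for n U p
    using that unfolding diff_realization_def final_diffeology_def by simp
  show "openin (D_topology (diff_realization X)) W"
    unfolding D_topology_def openin_final_topology
  proof (intro conjI ballI)
    show "W \<subseteq> dcarrier (diff_realization X)"
      using openin_subset[OF W]
      by (simp add: topspace_affine_realization diff_realization_def final_diffeology_def)
    fix i assume "i \<in> {(n, U, p). p \<in> plots (diff_realization X) n U}"
    then obtain n U q where i: "i = (n, U, q)" "q \<in> plots (diff_realization X) n U" by auto
    have "continuous_map (subtopology (Euclidean_space n) U) (affine_realization X) q"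
      using p[OF i(2)] by (simp add: continuous_diffeology_def)
    then have "openin (subtopology (Euclidean_space n) U)
        {a \<in> topspace (subtopology (Euclidean_space n) U). q a \<in> W}"
      using W unfolding continuous_map_def by blast
    then show "openin (case i of (n, U, p) \<Rightarrow> subtopology (Euclidean_space n) U)
        {a \<in> topspace (case i of (n, U, p) \<Rightarrow> subtopology (Euclidean_space n) U).
           (case i of (n, U, p) \<Rightarrow> p) a \<in> W}"
      by (simp add: i)
  qed
qed


section \<open>The weak equivalence\<close>

theorem proposition4p15:
  fixes X :: "'a simp_set"
  assumes "simplicial_set X"
  shows "(\<exists>f. weak_homotopy_equivalence (D_topology (diff_realization X)) (geom_realization X) f)
       \<or> (\<exists>g. weak_homotopy_equivalence (geom_realization X) (D_topology (diff_realization X)) g)"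
proof -
  obtain \<iota> r h where d: "continuous_map (geom_realization X) (affine_realization X) \<iota>"
    "continuous_map (affine_realization X) (geom_realization X) r"
    "continuous_map (prod_topology (top_of_set {0..1}) (affine_realization X)) (affine_realization X)
       (\<lambda>(\<tau>, q). h (\<tau>::real) q)"
    "\<And>p. p \<in> topspace (geom_realization X) \<Longrightarrow> r (\<iota> p) = p"
    "\<And>q. q \<in> topspace (affine_realization X) \<Longrightarrow> h 0 q = q"
    "\<And>q. q \<in> topspace (affine_realization X) \<Longrightarrow> h 1 q = \<iota> (r q)"
    "\<And>\<tau> p. p \<in> topspace (geom_realization X) \<Longrightarrow> h \<tau> (\<iota> p) = \<iota> p"
    using exists_deformation[OF assms] by blast
  have "weak_homotopy_equivalence (geom_realization X) (D_topology (diff_realization X)) \<iota>"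
    unfolding D_topology_diff_realization
    by (rule strong_deformation_retract_imp_weak_homotopy_equivalence[OF d])
  then show ?thesis by blast
qed

end
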